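(* Let $w>0$. If $P\subset H^2$ is an ordinary reduced polygon of minimal width $w$, then its diameter satisfies $$ \operatorname{diam}(P)\leq 2\operatorname{arcosh}\left(\frac{\cosh w+\sqrt{\cosh^2 w+8}}{4}\right), $$ with equality if and only if $P$ is the regular triangle (of minimal width $w$).
   Context: $H^2$ is the hyperbolic plane (constant curvature $-1$) with geodesic distance $d$. A set is convex if it contains the geodesic segment joining any two of its points; a convex body is a compact convex set with non-empty interior; a polygon is a convex body that is the convex hull of finitely many points, and a $k$-gon is a polygon with $k$ vertices (a vertex is a point of the generating set not in the convex hull of the others). Width: a line $\ell$ is a supporting line of a convex body $K$ if $K\cap\ell\neq\emptyset$ and $K$ lies in one of the closed half-planes bounded by $\ell$. The width of $K$ with respect to a supporting line $\ell$ is the distance between $\ell$ and a most distant supporting line $\ell'$ of $K$ from $\ell$. The minimal width (thickness) $w(K)$ is the minimum of the width over all supporting lines. $\operatorname{diam}(K)$ is the maximal distance between two points of $K$. Ordinary reduced polygon: let $n\ge 3$ be odd and let $P$ be a convex $n$-gon in $H^2$ with vertices $v_1,\dots,v_n$ in positively oriented cyclic order (indices mod $n$). The side opposite to $v_i$ is $[v_{i+\frac{n-1}{2}},v_{i+\frac{n+1}{2}}]$. $P$ of minimal width $w$ is called an ordinary reduced polygon if for every $i$ the distance of $v_i$ from its opposite side is $w$ and the orthogonal projection of $v_i$ onto the line of the opposite side lies in the relative interior of that side. *)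

theory Defs
  imports "HOL-Analysis.Analysis"
begin

section \<open>The hyperbolic plane (hyperboloid model)\<close>

text \<open>
  The hyperbolic plane of constant curvature -1 is realized as the upper sheet of the
  two-sheeted unit hyperboloid in Minkowski space of signature (2,1); the third coordinate
  is the time-like one. The geodesic distance is given by
  \<open>cosh (dist p q) = - mink p q\<close>.
\<close>

definition mink :: "real ^ 3 \<Rightarrow> real ^ 3 \<Rightarrow> real" where
  "mink x y = x $ 1 * y $ 1 + x $ 2 * y $ 2 - x $ 3 * y $ 3"

typedef hyp = "{x :: real ^ 3. mink x x = -1 \<and> x $ 3 > 0}"
  morphisms hvec Abs_hyp
proof
  show "vector [0, 0, 1] \<in> {x :: real ^ 3. mink x x = -1 \<and> x $ 3 > 0}"
    by (simp add: mink_def)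
qed

lemma mink_commute: "mink x y = mink y x"
  by (simp add: mink_def mult.commute)

lemma mink_hvec_self: "mink (hvec p) (hvec p) = -1"
  using hvec[of p] by simp

lemma hvec_pos: "hvec p $ 3 > 0"
  using hvec[of p] by simp

lemma time_square: "(hvec p $ 3)\<^sup>2 = 1 + (hvec p $ 1)\<^sup>2 + (hvec p $ 2)\<^sup>2"
  using mink_hvec_self[of p] by (simp add: mink_def power2_eq_square)

lemma time_square_product:
  "(hvec p $ 3 * hvec q $ 3)\<^sup>2 =
     (1 + hvec p $ 1 * hvec q $ 1 + hvec p $ 2 * hvec q $ 2)\<^sup>2
     + (hvec p $ 1 - hvec q $ 1)\<^sup>2 + (hvec p $ 2 - hvec q $ 2)\<^sup>2
     + (hvec p $ 1 * hvec q $ 2 - hvec p $ 2 * hvec q $ 1)\<^sup>2"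
  unfolding power_mult_distrib time_square by (simp add: power2_eq_square algebra_simps)

lemma neg_mink_ge_1: "1 \<le> - mink (hvec p) (hvec q)"
proof -
  have "(1 + hvec p $ 1 * hvec q $ 1 + hvec p $ 2 * hvec q $ 2)\<^sup>2 \<le> (hvec p $ 3 * hvec q $ 3)\<^sup>2"
    unfolding time_square_product by simp
  moreover have "0 \<le> hvec p $ 3 * hvec q $ 3"
    using hvec_pos[of p] hvec_pos[of q] by simp
  ultimately have "1 + hvec p $ 1 * hvec q $ 1 + hvec p $ 2 * hvec q $ 2 \<le> hvec p $ 3 * hvec q $ 3"
    using power2_le_imp_le by blast
  then show ?thesis by (simp add: mink_def)
qed

lemma neg_mink_eq_1_iff: "- mink (hvec p) (hvec q) = 1 \<longleftrightarrow> p = q"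
proof
  assume "- mink (hvec p) (hvec q) = 1"
  then have "hvec p $ 3 * hvec q $ 3 = 1 + hvec p $ 1 * hvec q $ 1 + hvec p $ 2 * hvec q $ 2"
    by (simp add: mink_def)
  then have "(hvec p $ 1 - hvec q $ 1)\<^sup>2 + (hvec p $ 2 - hvec q $ 2)\<^sup>2
      + (hvec p $ 1 * hvec q $ 2 - hvec p $ 2 * hvec q $ 1)\<^sup>2 = 0"
    using time_square_product[of p q] by simp
  then have eq12: "hvec p $ 1 = hvec q $ 1" "hvec p $ 2 = hvec q $ 2"
    by (smt (verit) power2_eq_iff_nonneg zero_le_power2 zero_eq_power2)+
  then have "(hvec p $ 3)\<^sup>2 = (hvec q $ 3)\<^sup>2"
    by (simp add: time_square)
  then have "hvec p $ 3 = hvec q $ 3"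
    using hvec_pos[of p] hvec_pos[of q] by (simp add: power2_eq_iff_nonneg)
  with eq12 have "hvec p = hvec q"
    by (simp add: vec_eq_iff forall_3)
  then show "p = q" by (simp add: hvec_inject)
qed (simp add: mink_hvec_self)

lemma gram_nonneg:
  assumes "a = - mink (hvec p) (hvec q)" "b = - mink (hvec q) (hvec r)" "c = - mink (hvec p) (hvec r)"
  shows "(c - a * b)\<^sup>2 \<le> (a\<^sup>2 - 1) * (b\<^sup>2 - 1)"
proof -
  define G :: "real ^ 3 \<Rightarrow> real ^ 3 \<Rightarrow> real ^ 3 \<Rightarrow> real" where
    "G x y z = mink x x * (mink y y * mink z z - mink y z * mink y z)
      - mink x y * (mink x y * mink z z - mink y z * mink x z)
      + mink x z * (mink x y * mink y z - mink y y * mink x z)" for x y z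
  have "G x y z = - (det (vector [x, y, z]))\<^sup>2" for x y z
    by (simp add: G_def mink_def det_3 power2_eq_square algebra_simps)
  then have "G (hvec p) (hvec q) (hvec r) \<le> 0" by simp
  then show ?thesis
    unfolding G_def mink_hvec_self using assms
    by (simp add: power2_eq_square algebra_simps)
qed

instantiation hyp :: metric_space
begin

definition dist_hyp :: "hyp \<Rightarrow> hyp \<Rightarrow> real" where
  "dist_hyp p q = arcosh (- mink (hvec p) (hvec q))"

definition uniformity_hyp :: "(hyp \<times> hyp) filter" where
  "uniformity_hyp = (INF e\<in>{0<..}. principal {(p, q). dist p q < e})"

definition open_hyp :: "hyp set \<Rightarrow> bool" where
  "open_hyp U \<longleftrightarrow> (\<forall>p\<in>U. eventually (\<lambda>(p', q). p' = p \<longrightarrow> q \<in> U) uniformity)"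

instance
proof
  fix p q :: hyp
  show "dist p q = 0 \<longleftrightarrow> p = q"
    unfolding dist_hyp_def arcosh_eq_0_iff_real[OF neg_mink_ge_1] by (rule neg_mink_eq_1_iff)
next
  fix p q r :: hyp
  let ?a = "- mink (hvec p) (hvec r)" and ?b = "- mink (hvec r) (hvec q)"
    and ?c = "- mink (hvec p) (hvec q)"
  have "\<bar>?c - ?a * ?b\<bar> \<le> sqrt ((?a\<^sup>2 - 1) * (?b\<^sup>2 - 1))"
    using real_sqrt_le_mono[OF gram_nonneg[OF refl refl refl, of p q r]] by simp
  then have "?c \<le> ?a * ?b + sqrt (?a\<^sup>2 - 1) * sqrt (?b\<^sup>2 - 1)"
    by (simp add: real_sqrt_mult)
  also have "\<dots> = cosh (arcosh ?a + arcosh ?b)"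
    by (simp only: cosh_add cosh_arcosh_real[OF neg_mink_ge_1] sinh_arcosh_real[OF neg_mink_ge_1])
  finally have "cosh (arcosh ?c) \<le> cosh (arcosh ?a + arcosh ?b)"
    by (simp only: cosh_arcosh_real[OF neg_mink_ge_1])
  moreover have "0 \<le> arcosh ?a" "0 \<le> arcosh ?b" "0 \<le> arcosh ?c"
    by (rule arcosh_nonneg_real[OF neg_mink_ge_1])+
  ultimately have "arcosh ?c \<le> arcosh ?a + arcosh ?b"
    by (simp add: cosh_real_nonneg_le_iff)
  then show "dist p q \<le> dist p r + dist q r"
    by (simp only: dist_hyp_def mink_commute[of "hvec q" "hvec r"])
qed (rule uniformity_hyp_def open_hyp_def)+

end

section \<open>Segments, lines, half-planes, orientation\<close>

definition hseg :: "hyp \<Rightarrow> hyp \<Rightarrow> hyp set" where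
  "hseg a b = {x. dist a x + dist x b = dist a b}"

definition relint_hseg :: "hyp \<Rightarrow> hyp \<Rightarrow> hyp set" where
  "relint_hseg a b = hseg a b - {a, b}"

text \<open>The line through two distinct points: the section of the hyperboloid by the plane through
  the origin spanned by them.\<close>

definition hline :: "hyp \<Rightarrow> hyp \<Rightarrow> hyp set" where
  "hline a b = {x. hvec x \<in> span {hvec a, hvec b}}"

definition is_hline :: "hyp set \<Rightarrow> bool" where
  "is_hline l \<longleftrightarrow> (\<exists>a b. a \<noteq> b \<and> l = hline a b)"

text \<open>Positive iff \<open>a\<close>, \<open>b\<close>, \<open>c\<close> is a counterclockwise triangle: central projection to the plane
  where the third coordinate is 1 (the Klein disc) turns the sign of this determinant into the
  usual orientation of a Euclidean triangle.\<close>

definition orient :: "hyp \<Rightarrow> hyp \<Rightarrow> hyp \<Rightarrow> real" where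
  "orient a b c = det (vector [hvec a, hvec b, hvec c])"

text \<open>The second closed half-plane bounded by the line is obtained by interchanging \<open>a\<close> and \<open>b\<close>.\<close>

definition is_halfplane_of :: "hyp set \<Rightarrow> hyp set \<Rightarrow> bool" where
  "is_halfplane_of H l \<longleftrightarrow>
     (\<exists>a b. a \<noteq> b \<and> l = hline a b \<and> H = {x. 0 \<le> orient a b x})"

text \<open>The vector tangent to the hyperboloid at \<open>q\<close> that is the initial direction (not normalized)
  of the geodesic from \<open>q\<close> to \<open>p\<close>, i.e. the component of \<open>p\<close> orthogonal to \<open>q\<close>. The form
  \<open>mink\<close>, restricted to a tangent plane, is the Riemannian metric.\<close>

definition dir :: "hyp \<Rightarrow> hyp \<Rightarrow> real ^ 3" where
  "dir q p = hvec p + mink (hvec q) (hvec p) *\<^sub>R hvec q"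

definition hangle :: "hyp \<Rightarrow> hyp \<Rightarrow> hyp \<Rightarrow> real" where
  "hangle p q r = arccos (mink (dir q p) (dir q r) /
     (sqrt (mink (dir q p) (dir q p)) * sqrt (mink (dir q r) (dir q r))))"

text \<open>\<open>q\<close> is the orthogonal projection of \<open>p\<close> to the line \<open>l\<close>. For \<open>p \<in> l\<close> the condition
  forces \<open>q = p\<close>.\<close>

definition is_orth_proj :: "hyp \<Rightarrow> hyp set \<Rightarrow> hyp \<Rightarrow> bool" where
  "is_orth_proj p l q \<longleftrightarrow> q \<in> l \<and> (\<forall>r\<in>l. mink (dir q p) (dir q r) = 0)"

section \<open>Convex bodies and width\<close>

definition hconvex :: "hyp set \<Rightarrow> bool" where
  "hconvex K \<longleftrightarrow> (\<forall>a\<in>K. \<forall>b\<in>K. hseg a b \<subseteq> K)"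

definition hconvex_body :: "hyp set \<Rightarrow> bool" where
  "hconvex_body K \<longleftrightarrow> compact K \<and> hconvex K \<and> interior K \<noteq> {}"

definition supporting_line :: "hyp set \<Rightarrow> hyp set \<Rightarrow> bool" where
  "supporting_line K l \<longleftrightarrow>
     is_hline l \<and> K \<inter> l \<noteq> {} \<and> (\<exists>H. is_halfplane_of H l \<and> K \<subseteq> H)"

text \<open>For convex bodies the supremum and the infimum below are over nonempty bounded sets (two
  supporting lines of \<open>K\<close> are at distance at most \<open>diameter K\<close>), and are a maximum and a
  minimum, by compactness.\<close>

definition width_wrt :: "hyp set \<Rightarrow> hyp set \<Rightarrow> real" where
  "width_wrt K l = (SUP l'\<in>{l'. supporting_line K l'}. setdist l l')"

definition minimal_width :: "hyp set \<Rightarrow> real" where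
  "minimal_width K = (INF l\<in>{l. supporting_line K l}. width_wrt K l)"

section \<open>Polygons\<close>

definition hpolygon :: "hyp set \<Rightarrow> bool" where
  "hpolygon P \<longleftrightarrow> hconvex_body P \<and> (\<exists>S. finite S \<and> P = hconvex hull S)"

text \<open>The set of vertices does not depend on the choice of the generating set \<open>S\<close>.\<close>

definition hvertices :: "hyp set \<Rightarrow> hyp set" where
  "hvertices P =
     {v. \<exists>S. finite S \<and> P = hconvex hull S \<and> v \<in> S \<and> v \<notin> hconvex hull (S - {v})}"

text \<open>\<open>P\<close> is an \<open>n\<close>-gon and \<open>v 0, \<dots>, v (n - 1)\<close> are its vertices in positively oriented cyclic
  order, expressed by every triple with increasing indices being counterclockwise.\<close>

definition ngon_with_vertices :: "hyp set \<Rightarrow> nat \<Rightarrow> (nat \<Rightarrow> hyp) \<Rightarrow> bool" where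
  "ngon_with_vertices P n v \<longleftrightarrow>
     hpolygon P \<and> bij_betw v {..<n} (hvertices P) \<and>
     (\<forall>i j k. i < j \<and> j < k \<and> k < n \<longrightarrow> 0 < orient (v i) (v j) (v k))"

definition ordinary_reduced_polygon :: "hyp set \<Rightarrow> bool" where
  "ordinary_reduced_polygon P \<longleftrightarrow>
     (\<exists>n v. 3 \<le> n \<and> odd n \<and> ngon_with_vertices P n v \<and>
       (\<forall>i<n. let a = v ((i + (n - 1) div 2) mod n); b = v ((i + (n + 1) div 2) mod n) in
          infdist (v i) (hseg a b) = minimal_width P \<and>
          (\<exists>q \<in> relint_hseg a b. is_orth_proj (v i) (hline a b) q)))"

text \<open>All sides are equal and all angles are equal.\<close>

definition regular_ngon :: "nat \<Rightarrow> hyp set \<Rightarrow> bool" where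
  "regular_ngon n P \<longleftrightarrow>
     (\<exists>v. ngon_with_vertices P n v \<and>
       (\<forall>i<n. \<forall>j<n. dist (v i) (v ((i + 1) mod n)) = dist (v j) (v ((j + 1) mod n))) \<and>
       (\<forall>i<n. \<forall>j<n. hangle (v ((i + n - 1) mod n)) (v i) (v ((i + 1) mod n))
                   = hangle (v ((j + n - 1) mod n)) (v j) (v ((j + 1) mod n))))"

abbreviation regular_triangle :: "hyp set \<Rightarrow> bool" where
  "regular_triangle \<equiv> regular_ngon 3"

end

theory Submission
  imports Defs
begin

text \<open>
  Let \<open>c = cosh w\<close>, and let \<open>b\<close> be the bound on the diameter. It is the side of the equilateral
  triangle of altitude \<open>w\<close>: this side \<open>d\<close> satisfies \<open>cosh d = c * cosh (d / 2)\<close> by the theorem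
  of Pythagoras, and \<open>cosh d \<le> c * cosh (d / 2)\<close> is equivalent to \<open>d \<le> b\<close> (\<open>cosh_le_half_iff\<close>).
  A polygon has the same diameter as its set of vertices, so the inequality has to be shown for
  the distance \<open>d\<close> of any two vertices.

  Let \<open>V a\<close> be the vertices, indexed cyclically modulo \<open>n = 2 * m + 1\<close>, and let \<open>T a\<close> be the
  foot of the altitude from \<open>V a\<close> to the opposite side. Two opposite vertices span two congruent
  right triangles with their feet. Hence the pieces into which the feet divide the sides are
  pairwise equal, and counting them shows that the chain of sides from \<open>V a\<close> to \<open>V k\<close> is as long
  as the opposite boundary path \<open>T a, V (a + m + 1), \<dots>, V (k + m), T k\<close> (\<open>chain_between_feet\<close>).
  So this path has length at least \<open>d = dist (V a) (V k)\<close>.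

  Now let \<open>a < k \<le> a + m\<close> and suppose that \<open>c * cosh (d / 2) \<le> cosh d\<close>, that is, \<open>w\<close> is at most
  the altitude of the equilateral triangle over the segment from \<open>V k\<close> to \<open>V a\<close>. Since \<open>T a\<close> has
  distance \<open>w\<close> from \<open>V a\<close>, it is seen from \<open>V k\<close> under at most the angle of this triangle, and
  likewise with \<open>a\<close> and \<open>k\<close> exchanged. So the convex chain that starts in \<open>V k\<close>, follows the
  path from \<open>T a\<close> to \<open>T k\<close> and ends in \<open>V a\<close> lies in the equilateral triangle and has length at
  most \<open>2 * d\<close> (\<open>chain_within_equilateral\<close>). On the other hand \<open>V k\<close> lies on the inner side of
  the side that contains \<open>T a\<close>, so the angle at \<open>T a\<close> is not obtuse and
  \<open>cosh d \<le> c * cosh (dist (V k) (T a))\<close>; hence the first piece of the chain has length at least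
  \<open>d / 2\<close>, and so has the last one. As the middle part has length at least \<open>d\<close>, equality holds
  everywhere (\<open>cosh_dist_vertices_le\<close>). This proves the bound. Moreover, equality means that the
  chain of sides from \<open>V a\<close> to \<open>V k\<close> is straight and that the angle at \<open>T a\<close> is right, which
  together force \<open>n = 3\<close>; and a triangle with three equal altitudes is equilateral
  (\<open>triangle_sides\<close>).
\<close>

section \<open>The hyperboloid and its triple product\<close>

lemma mink_add_left: "mink (x + y) z = mink x z + mink y z"
  and mink_add_right: "mink z (x + y) = mink z x + mink z y"
  and mink_diff_left: "mink (x - y) z = mink x z - mink y z"
  and mink_diff_right: "mink z (x - y) = mink z x - mink z y"
  and mink_scale_left: "mink (r *\<^sub>R x) z = r * mink x z"
  and mink_scale_right: "mink z (r *\<^sub>R x) = r * mink z x"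
  by (simp_all add: mink_def algebra_simps)

lemmas mink_linear = mink_add_left mink_add_right mink_diff_left mink_diff_right
  mink_scale_left mink_scale_right

text \<open>
  The determinant behind \<open>orient\<close>, written as a polynomial for arbitrary vectors, since normals
  and unnormalized combinations of points do not lie on the hyperboloid.
\<close>

definition tdet :: "real ^ 3 \<Rightarrow> real ^ 3 \<Rightarrow> real ^ 3 \<Rightarrow> real" where
  "tdet x y z = x $ 1 * (y $ 2 * z $ 3 - y $ 3 * z $ 2) + x $ 2 * (y $ 3 * z $ 1 - y $ 1 * z $ 3)
     + x $ 3 * (y $ 1 * z $ 2 - y $ 2 * z $ 1)"

lemma orient_tdet: "orient a b c = tdet (hvec a) (hvec b) (hvec c)"
  by (simp add: orient_def tdet_def det_3 algebra_simps)

lemma tdet_linear: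
  "tdet (x + x') y z = tdet x y z + tdet x' y z"
  "tdet y (x + x') z = tdet y x z + tdet y x' z"
  "tdet y z (x + x') = tdet y z x + tdet y z x'"
  "tdet (x - x') y z = tdet x y z - tdet x' y z"
  "tdet y (x - x') z = tdet y x z - tdet y x' z"
  "tdet y z (x - x') = tdet y z x - tdet y z x'"
  "tdet (r *\<^sub>R x) y z = r * tdet x y z"
  "tdet y (r *\<^sub>R x) z = r * tdet y x z"
  "tdet y z (r *\<^sub>R x) = r * tdet y z x"
  by (simp_all add: tdet_def algebra_simps)

lemma tdet_same: "tdet x x y = 0" "tdet x y x = 0" "tdet y x x = 0"
  by (simp_all add: tdet_def algebra_simps)

lemma tdet_rotate: "tdet x y z = tdet y z x"
  by (simp add: tdet_def algebra_simps)

lemma tdet_swap: "tdet y x z = - tdet x y z"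
  by (simp add: tdet_def algebra_simps)

lemma orient_rotate: "orient a b c = orient b c a"
  unfolding orient_tdet by (rule tdet_rotate)

lemma orient_swap: "orient b a c = - orient a b c"
  unfolding orient_tdet by (rule tdet_swap)

lemma orient_same: "orient a a b = 0" "orient a b a = 0" "orient b a a = 0"
  by (simp_all add: orient_tdet tdet_same)

text \<open>
  Four vectors of a three-dimensional space are linearly dependent. Pairing this relation with a
  suitable vector is how relations between orientations are obtained below.
\<close>

lemma cramer:
  "tdet y z u *\<^sub>R x - tdet x z u *\<^sub>R y + tdet x y u *\<^sub>R z - tdet x y z *\<^sub>R u = 0"
  by (simp add: vec_eq_iff forall_3 tdet_def algebra_simps)

text \<open>
  Directions at the point \<open>a\<close> form a plane, on which \<open>tdet a\<close> is an area form; this is the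
  three-term relation between areas. It replaces the addition of angles at \<open>a\<close>.
\<close>

lemma pluecker: "tdet a x z * tdet a y u = tdet a x y * tdet a z u + tdet a y z * tdet a x u"
  by (simp add: tdet_def algebra_simps)

text \<open>
  The Gram determinant with respect to a form of signature (2,1).
\<close>

lemma orient_square:
  "(orient p q r)\<^sup>2 = 1 - 2 * mink (hvec p) (hvec q) * mink (hvec q) (hvec r) * mink (hvec p) (hvec r)
     - (mink (hvec p) (hvec q))\<^sup>2 - (mink (hvec q) (hvec r))\<^sup>2 - (mink (hvec p) (hvec r))\<^sup>2"
proof -
  have "(tdet x y z)\<^sup>2 = - (mink x x * (mink y y * mink z z - mink y z * mink y z)
      - mink x y * (mink x y * mink z z - mink y z * mink x z)
      + mink x z * (mink x y * mink y z - mink y y * mink x z))" for x y z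
    by (simp add: mink_def tdet_def power2_eq_square algebra_simps)
  from this[of "hvec p" "hvec q" "hvec r"] show ?thesis
    unfolding orient_tdet mink_hvec_self by (simp add: power2_eq_square algebra_simps)
qed

lemma cosh_dist: "cosh (dist p q) = - mink (hvec p) (hvec q)"
  unfolding dist_hyp_def by (rule cosh_arcosh_real[OF neg_mink_ge_1])

lemma mink_dist: "mink (hvec p) (hvec q) = - cosh (dist p q)"
  by (simp add: cosh_dist)

lemma dist_eqI: "0 \<le> s \<Longrightarrow> cosh (dist p q) = cosh s \<Longrightarrow> dist p q = (s::real)"
  using cosh_real_nonneg_le_iff[of "dist p q" s] cosh_real_nonneg_le_iff[of s "dist p q"] by simp

text \<open>
  The form is positive definite on the orthogonal complement of a time-like vector.
\<close>

lemma null_orthogonal_eq_0: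
  assumes "mink u u = 0" "mink u (hvec a) = 0"
  shows "u = 0"
proof -
  have 1: "u$3 * hvec a$3 = u$1 * hvec a$1 + u$2 * hvec a$2" "u$1*u$1 + u$2*u$2 = u$3*u$3"
    using assms by (simp_all add: mink_def)
  have "(u$3 * hvec a$3)\<^sup>2 \<le> (u$1*u$1 + u$2*u$2) * ((hvec a$1)\<^sup>2 + (hvec a$2)\<^sup>2)"
    unfolding 1(1) using zero_le_power2[of "u$1 * hvec a$2 - u$2 * hvec a$1"]
    by (simp add: power2_eq_square algebra_simps)
  then have "(u$3)\<^sup>2 \<le> 0"
    unfolding 1(2) power_mult_distrib time_square by (simp add: power2_eq_square algebra_simps)
  then have "u$3 = 0" by simp
  moreover from this 1(2) have "u$1 = 0 \<and> u$2 = 0"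
    using sum_squares_eq_zero_iff[of "u$1" "u$2"] by simp
  ultimately show ?thesis by (simp add: vec_eq_iff forall_3)
qed

text \<open>
  The second assumption selects the upper sheet: vectors of the upper sheet have negative
  products with each other and positive products with the lower sheet.
\<close>

lemma timelike_multiple:
  assumes "mink u u < 0" "mink u (hvec a) < 0"
  obtains y r where "0 < r" "u = r *\<^sub>R hvec y"
proof -
  define r where "r = sqrt (- mink u u)"
  have r: "0 < r" "r * r = - mink u u" using assms(1) by (simp_all add: r_def)
  define x where "x = (1/r) *\<^sub>R u"
  have x1: "mink x x = -1" "mink x (hvec a) < 0"
    using r assms by (auto simp add: x_def mink_linear field_simps)
  have "x $ 3 > 0"
  proof (rule ccontr)
    assume "\<not> ?thesis"
    moreover have "x$3 \<noteq> 0"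
    proof
      assume "x$3 = 0"
      then have "x$1 * x$1 + x$2 * x$2 = -1" using x1(1) by (simp add: mink_def)
      then show False using sum_squares_ge_zero[of "x$1" "x$2"] by linarith
    qed
    ultimately have "- x \<in> {x. mink x x = -1 \<and> x $ 3 > 0}" using x1(1) by (simp add: mink_def)
    then have "hvec (Abs_hyp (- x)) = - x" by (rule Abs_hyp_inverse)
    then have "1 \<le> - mink (- x) (hvec a)" using neg_mink_ge_1[of "Abs_hyp (- x)" a] by simp
    moreover have "mink (- x) (hvec a) = - mink x (hvec a)" by (simp add: mink_def)
    ultimately show False using x1(2) by simp
  qed
  then have "hvec (Abs_hyp x) = x" using x1 by (intro Abs_hyp_inverse) simp
  then have "u = r *\<^sub>R hvec (Abs_hyp x)" using r(1) by (simp add: x_def)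
  with r(1) show thesis by (rule that)
qed

lemma unit_timelike:
  assumes "mink u u = -1" "mink u (hvec a) < 0"
  obtains y where "hvec y = u"
proof -
  obtain y r where r: "0 < r" "u = r *\<^sub>R hvec y"
    using assms by (auto intro: timelike_multiple[of u a])
  then have "r * r = 1" using assms(1) by (simp add: mink_linear mink_hvec_self)
  then have "r = 1" using r(1) by (simp add: square_eq_1_iff)
  then show thesis using r(2) that by simp
qed

section \<open>Segments\<close>

text \<open>
  The coefficients are those of spherical linear interpolation with hyperbolic sines. The
  difference \<open>u\<close> of the two sides is null and orthogonal to \<open>a\<close>, hence zero. The strict
  inequalities serve the relative interior.
\<close>

lemma hseg_combination:
  assumes "x \<in> hseg a b" "a \<noteq> b"
  obtains s t where "0 \<le> s" "0 \<le> t" "x \<noteq> b \<Longrightarrow> 0 < s" "x \<noteq> a \<Longrightarrow> 0 < t"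
    "hvec x = s *\<^sub>R hvec a + t *\<^sub>R hvec b"
proof -
  define y z where "y = dist a x" and "z = dist x b"
  have D: "dist a b = y + z" using assms(1) by (simp add: hseg_def y_def z_def)
  have S: "0 < sinh (y + z)" using assms(2) D by (metis sinh_real_pos_iff zero_less_dist_iff)
  define s t where "s = sinh z / sinh (y + z)" and "t = sinh y / sinh (y + z)"
  define u where "u = hvec x - s *\<^sub>R hvec a - t *\<^sub>R hvec b"
  have m: "mink (hvec x) (hvec a) = - cosh y" "mink (hvec x) (hvec b) = - cosh z"
    "mink (hvec a) (hvec b) = - cosh (y + z)" "mink (hvec b) (hvec a) = - cosh (y + z)"
    "mink (hvec a) (hvec x) = - cosh y" "mink (hvec b) (hvec x) = - cosh z"
    unfolding D[symmetric] by (simp_all add: mink_dist y_def z_def dist_commute)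
  have q: "cosh y * cosh y = 1 + sinh y * sinh y" "cosh z * cosh z = 1 + sinh z * sinh z"
    using cosh_square_eq[of y] cosh_square_eq[of z] by (simp_all add: power2_eq_square)
  have e1: "sinh z + sinh y * cosh (y + z) = cosh y * sinh (y + z)"
    unfolding sinh_add cosh_add using arg_cong[OF q(1), of "\<lambda>t. t * sinh z"]
    by (simp add: algebra_simps)
  have e2: "sinh z * cosh (y + z) + sinh y = cosh z * sinh (y + z)"
    unfolding sinh_add cosh_add using arg_cong[OF q(2), of "\<lambda>t. t * sinh y"]
    by (simp add: algebra_simps)
  have e3: "sinh z * cosh y + sinh y * cosh z = sinh (y + z)"
    unfolding sinh_add by simp
  have "mink u (hvec a) = - cosh y + (sinh z + sinh y * cosh (y + z)) / sinh (y + z)"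
    unfolding u_def mink_linear mink_hvec_self m s_def t_def by (simp add: add_divide_distrib)
  then have z1: "mink u (hvec a) = 0" using S unfolding e1 by simp
  have "mink u (hvec b) = - cosh z + (sinh z * cosh (y + z) + sinh y) / sinh (y + z)"
    unfolding u_def mink_linear mink_hvec_self m s_def t_def by (simp add: add_divide_distrib)
  then have z2: "mink u (hvec b) = 0" using S unfolding e2 by simp
  have "mink u (hvec x) = - 1 + (sinh z * cosh y + sinh y * cosh z) / sinh (y + z)"
    unfolding u_def mink_linear mink_hvec_self m s_def t_def by (simp add: add_divide_distrib)
  then have z3: "mink u (hvec x) = 0" using S unfolding e3 by simp
  have "mink u u = mink u (hvec x) - s * mink u (hvec a) - t * mink u (hvec b)"
    by (subst (2) u_def) (simp only: mink_linear)
  then have "u = 0" using z1 z2 z3 by (intro null_orthogonal_eq_0[of u a]) simp_all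
  show thesis
  proof (rule that[of s t])
    show "0 \<le> s" "0 \<le> t" using S by (simp_all add: s_def t_def y_def z_def)
    show "x \<noteq> b \<Longrightarrow> 0 < s" "x \<noteq> a \<Longrightarrow> 0 < t" using S
      by (auto simp add: s_def t_def y_def z_def)
    show "hvec x = s *\<^sub>R hvec a + t *\<^sub>R hvec b" using \<open>u = 0\<close> by (simp add: u_def algebra_simps)
  qed
qed

text \<open>
  With \<open>S = sinh (dist a b)\<close>, the two partial distances have hyperbolic sines \<open>t * S\<close> and
  \<open>s * S\<close>, so the addition theorem evaluates the hyperbolic cosine of their sum.
\<close>

lemma combination_hseg:
  assumes "0 \<le> s" "0 \<le> t" and x: "hvec x = s *\<^sub>R hvec a + t *\<^sub>R hvec b"
  shows "dist a x + dist x b = dist a b"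
proof -
  define C where "C = cosh (dist a b)"
  have m: "mink (hvec a) (hvec b) = - C" "mink (hvec b) (hvec a) = - C"
    by (simp_all add: mink_dist C_def dist_commute)
  have n: "s * s + t * t + 2 * s * t * C = 1"
    using mink_hvec_self[of x] unfolding x mink_linear mink_hvec_self m
    by (simp add: algebra_simps)
  have ca: "cosh (dist a x) = s + t * C" and cb: "cosh (dist x b) = s * C + t"
    unfolding cosh_dist x mink_linear mink_hvec_self m by (simp_all add: algebra_simps)
  have sq: "sinh r * sinh r = cosh r * cosh r - 1" for r :: real
    using cosh_square_eq[of r] by (simp add: power2_eq_square)
  have S: "C * C - 1 = sinh (dist a b) * sinh (dist a b)"
    unfolding C_def by (rule sq[symmetric])
  have "sinh (dist a x) * sinh (dist a x) = (s + t * C) * (s + t * C) - 1"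
    unfolding sq ca ..
  also have "\<dots> = t * t * (C * C - 1)" using n by algebra
  also have "\<dots> = (t * sinh (dist a b)) * (t * sinh (dist a b))"
    unfolding S by (simp only: mult_ac)
  finally have "(sinh (dist a x))\<^sup>2 = (t * sinh (dist a b))\<^sup>2" by (simp only: power2_eq_square)
  then have sa: "sinh (dist a x) = t * sinh (dist a b)"
    by (rule power2_eq_imp_eq) (use assms in simp_all)
  have "sinh (dist x b) * sinh (dist x b) = (s * C + t) * (s * C + t) - 1"
    unfolding sq cb ..
  also have "\<dots> = s * s * (C * C - 1)" using n by algebra
  also have "\<dots> = (s * sinh (dist a b)) * (s * sinh (dist a b))"
    unfolding S by (simp only: mult_ac)
  finally have "(sinh (dist x b))\<^sup>2 = (s * sinh (dist a b))\<^sup>2" by (simp only: power2_eq_square)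
  then have sb: "sinh (dist x b) = s * sinh (dist a b)"
    by (rule power2_eq_imp_eq) (use assms in simp_all)
  have "cosh (dist a x + dist x b) = (s + t * C) * (s * C + t) + s * t * (C * C - 1)"
    unfolding cosh_add ca cb sa sb S by (simp add: mult_ac)
  also have "\<dots> = (s * s + t * t + 2 * s * t * C) * C" by (simp add: algebra_simps)
  also have "\<dots> = cosh (dist a b)" unfolding n by (simp add: C_def)
  finally have "cosh (dist a b) = cosh (dist a x + dist x b)" by (rule sym)
  then show ?thesis by (intro dist_eqI[symmetric]) simp_all
qed

lemma orient_hseg: "x \<in> hseg a b \<Longrightarrow> orient a x b = 0"
proof (cases "a = b")
  case False
  assume "x \<in> hseg a b"
  from hseg_combination[OF this False] obtain s t where "hvec x = s *\<^sub>R hvec a + t *\<^sub>R hvec b" by metis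
  then show ?thesis by (simp add: orient_tdet tdet_linear tdet_same)
qed (simp add: orient_same)

section \<open>Orthogonal projections\<close>

text \<open>
  The theorem of Pythagoras: orthogonality of the directions at \<open>t\<close> is this identity.
\<close>

lemma cosh_dist_foot:
  assumes "is_orth_proj p l t" "r \<in> l"
  shows "cosh (dist p r) = cosh (dist p t) * cosh (dist t r)"
proof -
  have "mink (dir t p) (dir t r) = 0" using assms by (simp add: is_orth_proj_def)
  then have "mink (hvec p) (hvec r) + mink (hvec t) (hvec p) * mink (hvec t) (hvec r) = 0"
    unfolding dir_def mink_linear mink_hvec_self
    by (simp add: mink_commute[of "hvec p" "hvec t"] algebra_simps)
  then show ?thesis unfolding cosh_dist by (simp add: mink_commute[of "hvec p" "hvec t"])
qed

lemma dist_foot_le: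
  assumes "is_orth_proj p l t" "r \<in> l"
  shows "dist p t \<le> dist p r"
proof -
  have "cosh (dist p t) * 1 \<le> cosh (dist p t) * cosh (dist t r)"
    by (intro mult_left_mono cosh_real_ge_1) simp
  then have "cosh (dist p t) \<le> cosh (dist p r)" using cosh_dist_foot[OF assms] by simp
  then show ?thesis by (simp add: cosh_real_nonneg_le_iff)
qed

lemma endpoints_in_hline: "a \<in> hline a b" "b \<in> hline a b"
  by (simp_all add: hline_def span_base)

text \<open>
  Both sides are linear functions of \<open>x\<close> that vanish on the line, because the vector
  \<open>N = p - cosh (dist p t) * t\<close> is a normal of the plane spanned by \<open>a\<close> and \<open>b\<close>. Geometrically,
  for \<open>p\<close> off the line, \<open>x\<close> lies on the side of \<open>p\<close> if and only if the angle at \<open>t\<close> between \<open>p\<close>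
  and \<open>x\<close> is not obtuse.
\<close>

lemma orient_foot:
  assumes "is_orth_proj p (hline a b) t"
  shows "orient a b x * ((cosh (dist p t))\<^sup>2 - 1) =
    orient a b p * (cosh (dist p t) * cosh (dist t x) - cosh (dist p x))"
proof -
  define c where "c = cosh (dist p t)"
  define N where "N = hvec p - c *\<^sub>R hvec t"
  have pt: "mink (hvec p) (hvec t) = - c" "mink (hvec t) (hvec p) = - c"
    by (simp_all add: c_def mink_dist dist_commute)
  have N: "mink N (hvec r) = c * cosh (dist t r) - cosh (dist p r)" for r
    by (simp add: N_def mink_linear mink_dist)
  have Np: "mink N (hvec p) = c * c - 1"
    unfolding N by (simp add: c_def dist_commute)
  have Nab: "mink N (hvec a) = 0" "mink N (hvec b) = 0"
    unfolding N c_def using cosh_dist_foot[OF assms] endpoints_in_hline by simp_all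
  have "mink N (tdet (hvec b) (hvec p) (hvec x) *\<^sub>R hvec a - tdet (hvec a) (hvec p) (hvec x) *\<^sub>R hvec b
      + tdet (hvec a) (hvec b) (hvec x) *\<^sub>R hvec p - tdet (hvec a) (hvec b) (hvec p) *\<^sub>R hvec x) = 0"
    unfolding cramer by (simp add: mink_def)
  then have "orient a b x * (c * c - 1) = orient a b p * mink N (hvec x)"
    unfolding mink_linear Nab Np orient_tdet by simp
  then show ?thesis unfolding N c_def by (simp add: power2_eq_square)
qed

lemma infdist_hseg_foot:
  assumes "is_orth_proj p (hline a b) q" "q \<in> relint_hseg a b"
  shows "infdist p (hseg a b) = dist p q"
proof (rule antisym)
  have q: "q \<in> hseg a b" "q \<noteq> a" using assms(2) by (auto simp: relint_hseg_def)
  show "infdist p (hseg a b) \<le> dist p q" using q by (intro infdist_le)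
  have "a \<noteq> b"
  proof
    assume "a = b"
    then have "dist a q = 0" using q(1) by (simp add: hseg_def dist_commute)
    then show False using q(2) by simp
  qed
  have "dist p q \<le> dist p r" if r: "r \<in> hseg a b" for r
  proof -
    obtain s t where "hvec r = s *\<^sub>R hvec a + t *\<^sub>R hvec b"
      using hseg_combination[OF r \<open>a \<noteq> b\<close>] by metis
    then have "r \<in> hline a b" by (simp add: hline_def span_add span_base span_scale)
    with assms(1) show ?thesis by (rule dist_foot_le)
  qed
  then show "dist p q \<le> infdist p (hseg a b)"
    using q(1) by (auto simp: infdist_def intro!: cINF_greatest)
qed

lemma hangle_cosh:
  "hangle p q r = arccos ((cosh (dist q p) * cosh (dist q r) - cosh (dist p r)) /
    (sqrt ((cosh (dist q p))\<^sup>2 - 1) * sqrt ((cosh (dist q r))\<^sup>2 - 1)))"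
proof -
  have "mink (dir q x) (dir q y) = cosh (dist q x) * cosh (dist q y) - cosh (dist x y)" for x y
    unfolding dir_def mink_linear mink_hvec_self by (simp add: mink_dist dist_commute)
  then show ?thesis unfolding hangle_def by (simp add: power2_eq_square)
qed

section \<open>Length of convex chains\<close>

text \<open>
  The line from the vertex \<open>a\<close> through the point \<open>p\<close> of the triangle \<open>a X b\<close> leaves it at the
  point \<open>y\<close> of the side \<open>X b\<close>. The relation of Cramer between \<open>a, p, X, b\<close> has one part in the
  span of \<open>X, b\<close> and the other in the span of \<open>a, p\<close>; \<open>y\<close> is its common value, normalized. The
  factor \<open>\<sigma>\<close> serves both orientations of the triangle.
\<close>

lemma cut_triangle:
  fixes \<sigma> :: real
  assumes "0 < \<sigma> * orient X b a" "0 < \<sigma> * orient a p b" "0 \<le> \<sigma> * orient a X p"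
  obtains y l u k where "0 < l" "0 \<le> u" "hvec y = l *\<^sub>R hvec X + u *\<^sub>R hvec b"
    "0 < k" "hvec p = k *\<^sub>R hvec y + (orient X b p / orient X b a) *\<^sub>R hvec a"
proof -
  define s t D1 D0 where "s = \<sigma> * orient a p b" and "t = \<sigma> * orient a X p"
    and "D1 = orient X b p" and "D0 = orient X b a"
  define q where "q = s *\<^sub>R hvec X + t *\<^sub>R hvec b"
  have st: "0 < s" "0 \<le> t" "0 < \<sigma> * D0" using assms by (simp_all add: s_def t_def D0_def)
  have "0 < s * s" "0 \<le> s * t * cosh (dist X b)" "0 \<le> t * t" "0 \<le> t * cosh (dist X b)"
    using st by simp_all
  then have "0 < s * s + t * t + 2 * (s * t * cosh (dist X b))" "0 < s + t * cosh (dist X b)"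
    using st(1) by linarith+
  then have "mink q q < 0" "mink q (hvec X) < 0"
    unfolding q_def mink_linear mink_hvec_self
    by (simp_all add: mink_dist dist_commute algebra_simps)
  then obtain r y where r: "0 < r" "q = r *\<^sub>R hvec y" by (rule timelike_multiple)
  have y: "hvec y = (s / r) *\<^sub>R hvec X + (t / r) *\<^sub>R hvec b"
  proof -
    have "hvec y = (1 / r) *\<^sub>R q" using r by simp
    then show ?thesis by (simp add: q_def scaleR_add_right)
  qed
  have D: "tdet (hvec p) (hvec X) (hvec b) = D1" "tdet (hvec a) (hvec X) (hvec b) = D0"
    unfolding D1_def D0_def orient_tdet by (simp_all add: tdet_def algebra_simps)
  have "tdet (hvec a) (hvec p) (hvec X) = - orient a X p"
    unfolding orient_tdet by (simp add: tdet_def algebra_simps)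
  then have "D1 *\<^sub>R hvec a - D0 *\<^sub>R hvec p + orient a p b *\<^sub>R hvec X + orient a X p *\<^sub>R hvec b = 0"
    using cramer[of "hvec p" "hvec X" "hvec b" "hvec a"] unfolding D orient_tdet by simp
  then have "\<sigma> *\<^sub>R (D1 *\<^sub>R hvec a - D0 *\<^sub>R hvec p + orient a p b *\<^sub>R hvec X + orient a X p *\<^sub>R hvec b) = 0"
    by simp
  then have "(\<sigma> * D0) *\<^sub>R hvec p = q + (\<sigma> * D1) *\<^sub>R hvec a"
    unfolding q_def s_def t_def by (simp add: algebra_simps)
  then have "(1 / (\<sigma> * D0)) *\<^sub>R ((\<sigma> * D0) *\<^sub>R hvec p) = (1 / (\<sigma> * D0)) *\<^sub>R (q + (\<sigma> * D1) *\<^sub>R hvec a)"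
    by simp
  moreover have "\<sigma> * D0 \<noteq> 0" using st(3) by linarith
  ultimately have "hvec p = (1 / (\<sigma> * D0)) *\<^sub>R (q + (\<sigma> * D1) *\<^sub>R hvec a)"
    by simp
  then have "hvec p = (r / (\<sigma> * D0)) *\<^sub>R hvec y + (D1 / D0) *\<^sub>R hvec a"
    using \<open>\<sigma> * D0 \<noteq> 0\<close> unfolding r(2) by (simp add: scaleR_add_right)
  moreover have "0 < r / (\<sigma> * D0)" "0 < s / r" "0 \<le> t / r" using st r(1) by simp_all
  ultimately show thesis using that y unfolding D1_def D0_def by blast
qed

fun chain_length :: "hyp \<Rightarrow> hyp list \<Rightarrow> hyp \<Rightarrow> real" where
  "chain_length a [] b = dist a b"
| "chain_length a (p # ps) b = dist a p + chain_length p ps b"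

text \<open>
  The inequalities for the inner vertices are weak because a foot is collinear with the two
  vertices of its side, which follow each other on the chains below. The inequality for \<open>b\<close> is
  strict in order that the triangle that remains after cutting along an edge is not degenerate.
\<close>

fun left_chain :: "hyp \<Rightarrow> hyp list \<Rightarrow> hyp \<Rightarrow> bool" where
  "left_chain a [] b \<longleftrightarrow> True"
| "left_chain a (p # ps) b \<longleftrightarrow>
     (\<forall>q\<in>set ps. 0 \<le> orient a p q) \<and> 0 < orient a p b \<and> left_chain p ps b"

text \<open>
  Prolong the first edge to the point \<open>y\<close> of the opposite side. The rest of the chain lies in the
  smaller triangle \<open>p y b\<close>, and replacing the path over \<open>X\<close> by the path over \<open>y\<close> does not lengthen
  it by the triangle inequality; this is an induction on the number of edges. The last vertex
  before \<open>b\<close> is allowed to lie on the line \<open>X b\<close>.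
\<close>

lemma chain_length_le:
  assumes "left_chain a ps b" "0 < orient X b a"
    "\<And>p. p \<in> set ps \<Longrightarrow> 0 \<le> orient a X p" "\<And>p. p \<in> set ps \<Longrightarrow> 0 \<le> orient X b p"
    "\<And>p. p \<in> set (butlast ps) \<Longrightarrow> 0 < orient X b p"
  shows "chain_length a ps b \<le> dist a X + dist X b"
  using assms
proof (induction ps arbitrary: a X)
  case Nil
  then show ?case by (simp add: dist_triangle)
next
  case (Cons p ps)
  have *: "0 < 1 * orient X b a" "0 < 1 * orient a p b" "0 \<le> 1 * orient a X p"
    using Cons.prems by simp_all
  then obtain y l u k where y: "0 < l" "0 \<le> u" "hvec y = l *\<^sub>R hvec X + u *\<^sub>R hvec b"
    "0 < k" "hvec p = k *\<^sub>R hvec y + (orient X b p / orient X b a) *\<^sub>R hvec a"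
    by (rule cut_triangle)
  have "0 \<le> orient X b p / orient X b a" using Cons.prems(2,4) by simp
  then have "dist y p + dist p a = dist y a"
    using combination_hseg[OF less_imp_le[OF y(4)] _ y(5)] by blast
  then have d1: "dist a p + dist p y = dist a y" by (simp add: dist_commute)
  have d2: "dist X y + dist y b = dist X b"
    using y by (intro combination_hseg[OF _ _ y(3)]) simp_all
  have "chain_length p ps b \<le> dist p y + dist y b"
  proof (cases ps)
    case Nil
    then show ?thesis by (simp add: dist_triangle)
  next
    case (Cons p' ps')
    have yb: "orient y b q = l * orient X b q" for q
      unfolding orient_tdet y(3) by (simp add: tdet_linear tdet_same)
    have yp: "k * orient p y q = (orient X b p / orient X b a) * (orient a p q)" for q
    proof -
      have "k * tdet (hvec p) (hvec y) (hvec q) = tdet (hvec p) (hvec p - (orient X b p / orient X b a) *\<^sub>R hvec a) (hvec q)"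
        by (simp add: y(5) tdet_linear tdet_same)
      also have "\<dots> = - (orient X b p / orient X b a) * tdet (hvec p) (hvec a) (hvec q)"
        by (simp add: tdet_linear tdet_same)
      also have "\<dots> = (orient X b p / orient X b a) * tdet (hvec a) (hvec p) (hvec q)"
        by (subst tdet_swap) simp
      finally show ?thesis by (simp add: orient_tdet)
    qed
    show ?thesis
    proof (rule Cons.IH)
      show "left_chain p ps b" using Cons.prems(1) by simp
      show "0 < orient y b p" unfolding yb using y(1) Cons.prems(5)[of p] Cons by simp
      show "0 \<le> orient y b q" if "q \<in> set ps" for q
        unfolding yb using y(1) Cons.prems(4)[of q] that by simp
      show "0 < orient y b q" if "q \<in> set (butlast ps)" for q
        unfolding yb using y(1) Cons.prems(5)[of q] that Cons by simp
      show "0 \<le> orient p y q" if "q \<in> set ps" for q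
      proof -
        have "0 \<le> orient a p q" using Cons.prems(1) that by simp
        then have "0 \<le> k * orient p y q" unfolding yp
          using \<open>0 \<le> orient X b p / orient X b a\<close> by (intro mult_nonneg_nonneg)
        then show ?thesis using y(4) by (simp add: zero_le_mult_iff)
      qed
    qed
  qed
  then have "chain_length a (p # ps) b \<le> dist a y + dist y b" using d1 by simp
  also have "\<dots> \<le> dist a X + dist X b" using d2 dist_triangle[of a y X] by simp
  finally show ?case .
qed

lemma chain_length_upt:
  assumes "i \<le> j"
  shows "chain_length p (map V [i..<Suc j]) q =
    dist p (V i) + (\<Sum>l=i..<j. dist (V l) (V (Suc l))) + dist (V j) q"
  using assms
proof (induction arbitrary: p rule: inc_induct)
  case base
  then show ?case by simp
next
  case (step l)
  then have "chain_length p (map V [l..<Suc j]) q = dist p (V l) + chain_length (V l) (map V [Suc l..<Suc j]) q"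
    by (subst upt_conv_Cons) simp_all
  then show ?case using step by (simp add: sum.atLeast_Suc_lessThan)
qed

lemma left_chain_upt:
  assumes "i \<le> j"
    and "\<And>a b c. i \<le> a \<Longrightarrow> a < b \<Longrightarrow> b < c \<Longrightarrow> c \<le> j \<Longrightarrow> 0 \<le> orient (V a) (V b) (V c)"
    and "\<And>a b. i \<le> a \<Longrightarrow> a < b \<Longrightarrow> b \<le> j \<Longrightarrow> 0 < orient (V a) (V b) q"
  shows "left_chain (V i) (map V [Suc i..<Suc j]) q"
  using assms
proof (induction rule: inc_induct)
  case base
  then show ?case by simp
next
  case (step l)
  have "left_chain (V (Suc l)) (map V [Suc (Suc l)..<Suc j]) q"
    by (rule step.IH) (use step.prems in auto)
  moreover have "[Suc l..<Suc j] = Suc l # [Suc (Suc l)..<Suc j]"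
    using step.hyps by (intro upt_conv_Cons) simp
  moreover have "0 \<le> orient (V l) (V (Suc l)) (V c)" if "c \<in> set [Suc (Suc l)..<Suc j]" for c
    using step.prems(1)[of l "Suc l" c] that by auto
  moreover have "0 < orient (V l) (V (Suc l)) q" using step by simp
  ultimately show ?case by simp
qed

lemma dist_le_path:
  assumes "i \<le> j"
  shows "dist (V i) (V j) \<le> (\<Sum>l=i..<j. dist (V l) (V (Suc l)))"
  using assms
proof (induction rule: dec_induct)
  case (step l)
  then show ?case using dist_triangle[of "V i" "V (Suc l)" "V l"] by simp
qed simp

section \<open>The equilateral triangle over a segment\<close>

text \<open>
  The apex is a combination of \<open>A + B\<close> and of the normal \<open>N\<close> of their plane; its coefficients
  are forced by the two distances and by the normalization.
\<close>

lemma equilateral_apex: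
  assumes "A \<noteq> B"
  obtains Q where "dist A Q = dist A B" "dist Q B = dist A B"
    "orient B A Q = sqrt (2 * cosh (dist A B) + 1) * (cosh (dist A B) - 1)"
proof -
  define C where "C = cosh (dist A B)"
  have C: "1 < C" unfolding C_def using assms cosh_real_nonneg_less_iff[of 0 "dist A B"] by simp
  define N :: "real ^ 3" where "N = vector [hvec A $ 2 * hvec B $ 3 - hvec A $ 3 * hvec B $ 2,
     hvec A $ 3 * hvec B $ 1 - hvec A $ 1 * hvec B $ 3,
     hvec A $ 2 * hvec B $ 1 - hvec A $ 1 * hvec B $ 2]"
  have N: "mink N x = tdet (hvec A) (hvec B) x" "mink x N = tdet (hvec A) (hvec B) x" for x
    by (simp_all add: N_def mink_def tdet_def algebra_simps)
  have AB: "mink (hvec A) (hvec B) = - C" "mink (hvec B) (hvec A) = - C"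
    by (simp_all add: mink_dist C_def dist_commute)
  have "mink N N = (mink (hvec A) (hvec B))\<^sup>2 - mink (hvec A) (hvec A) * mink (hvec B) (hvec B)"
    by (simp add: N_def mink_def power2_eq_square algebra_simps)
  then have NN: "mink N N = (C + 1) * (C - 1)"
    by (simp add: AB mink_hvec_self power2_eq_square algebra_simps)
  define r where "r = sqrt (2 * C + 1)"
  have r: "r * r = 2 * C + 1" using C by (simp add: r_def)
  define e where "e = C + 1"
  have e: "e \<noteq> 0" using C by (simp add: e_def)
  define u where "u = (1 / e) *\<^sub>R (C *\<^sub>R (hvec A + hvec B) - r *\<^sub>R N)"
  have NA: "mink N (hvec A) = 0" "mink N (hvec B) = 0" "mink (hvec A) N = 0" "mink (hvec B) N = 0"
    unfolding N by (simp_all add: tdet_same)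
  have "mink u (hvec A) = (1 / e) * (- C * e)"
    unfolding u_def mink_linear mink_hvec_self AB NA by (simp add: e_def algebra_simps)
  then have uA: "mink u (hvec A) = - C" using e by simp
  have "mink u (hvec B) = (1 / e) * (- C * e)"
    unfolding u_def mink_linear mink_hvec_self AB NA by (simp add: e_def algebra_simps)
  then have uB: "mink u (hvec B) = - C" using e by simp
  have "mink u N = (1 / e) * (- r * (C - 1) * e)"
    unfolding u_def mink_linear NN NA by (simp add: e_def mult_ac)
  then have uN: "mink u N = - r * (C - 1)" using e by simp
  have "mink u u = (1 / e) * (C * (mink u (hvec A) + mink u (hvec B)) - r * mink u N)"
    by (subst (2) u_def) (simp only: mink_linear)
  also have "\<dots> = (1 / e) * ((2 * C + 1) * (C - 1) - 2 * C * C)"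
    unfolding uA uB uN r[symmetric] by (simp add: algebra_simps)
  also have "(2 * C + 1) * (C - 1) - 2 * C * C = - e" by (simp add: e_def algebra_simps)
  also have "(1 / e) * - e = -1" using e by simp
  finally have "mink u u = -1" .
  moreover have "mink u (hvec A) < 0" using uA C by simp
  ultimately obtain Q where Q: "hvec Q = u" by (rule unit_timelike)
  show thesis
  proof (rule that[of Q])
    have "cosh (dist Q A) = C" "cosh (dist Q B) = C" by (simp_all add: cosh_dist Q uA uB)
    then show "dist A Q = dist A B" "dist Q B = dist A B"
      by (auto intro!: dist_eqI simp: C_def dist_commute)
    have "orient B A Q = - mink u N"
      unfolding orient_tdet Q N by (rule tdet_swap)
    then show "orient B A Q = sqrt (2 * cosh (dist A B) + 1) * (cosh (dist A B) - 1)"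
      unfolding uN r_def C_def by simp
  qed
qed

text \<open>
  In the tangent plane at \<open>a\<close>, with its metric \<open>mink x y + mink a x * mink a y\<close>, this expresses
  the area of \<open>x, y\<close> by the components of \<open>x\<close> and \<open>y\<close> along \<open>z\<close> and perpendicular to it: the
  sine of a difference of angles.
\<close>

lemma tdet_angle:
  assumes "mink a a = -1"
  shows "tdet a x y * (mink z z + mink a z * mink a z) =
    tdet a x z * (mink y z + mink a y * mink a z) - tdet a y z * (mink x z + mink a x * mink a z)"
proof -
  define v where "v = tdet x y z *\<^sub>R a - tdet a y z *\<^sub>R x + tdet a x z *\<^sub>R y - tdet a x y *\<^sub>R z"
  have "v = 0" unfolding v_def by (rule cramer)
  then have "mink v z + mink a v * mink a z = 0" by (simp add: mink_def)
  then show ?thesis unfolding v_def mink_linear assms by (simp add: algebra_simps)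
qed

text \<open>
  Here \<open>C\<close>, \<open>c\<close>, \<open>\<alpha>\<close> are the hyperbolic cosines of \<open>dist A B\<close>, \<open>dist B p\<close>, \<open>dist A p\<close>, and \<open>s\<close>
  is the orientation of the triangle; the conclusion compares the tangents of the angle \<open>BAp\<close>
  and of the angle of the equilateral triangle. Squared, it is a quadratic inequality in \<open>\<alpha>\<close>
  with a non-positive discriminant, exactly because of the assumption on \<open>c\<close>.
\<close>

lemma below_apex_numeric:
  fixes C c \<alpha> s :: real
  assumes C: "1 < C" and c: "c\<^sup>2 * (C + 1) \<le> 2 * C\<^sup>2" and q: "0 \<le> C * \<alpha> - c"
    and s: "s\<^sup>2 = 1 + 2 * C * \<alpha> * c - C\<^sup>2 - \<alpha>\<^sup>2 - c\<^sup>2"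
  shows "s * (C\<^sup>2 - C) \<le> sqrt (2 * C + 1) * (C - 1) * (C * \<alpha> - c)"
proof -
  have "2 * ((2 * C + 1) * (C * \<alpha> - c)\<^sup>2 - C\<^sup>2 * s\<^sup>2) =
    (C + 1) * ((2 * C * \<alpha> - (C + 1) * c)\<^sup>2 + (C - 1) * (2 * C\<^sup>2 - c\<^sup>2 * (C + 1)))"
    unfolding s by (simp add: power2_eq_square algebra_simps)
  moreover have "0 \<le> \<dots>" using C c by simp
  ultimately have "0 \<le> 2 * ((2 * C + 1) * (C * \<alpha> - c)\<^sup>2 - C\<^sup>2 * s\<^sup>2)" by (simp only:)
  then have "C\<^sup>2 * s\<^sup>2 \<le> (2 * C + 1) * (C * \<alpha> - c)\<^sup>2" by simp
  then have "(C * s)\<^sup>2 \<le> (sqrt (2 * C + 1) * (C * \<alpha> - c))\<^sup>2"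
    using C by (simp add: power_mult_distrib)
  then have "C * s \<le> sqrt (2 * C + 1) * (C * \<alpha> - c)"
    using C q by (intro power2_le_imp_le[of "C * s"]) simp_all
  then have "(C - 1) * (C * s) \<le> (C - 1) * (sqrt (2 * C + 1) * (C * \<alpha> - c))"
    using C by (intro mult_left_mono) simp_all
  then show ?thesis by (simp add: power2_eq_square algebra_simps)
qed

text \<open>
  The assumption on \<open>w\<close> says that \<open>w\<close> is at most the altitude of the equilateral triangle
  \<open>A B Q\<close>. Then the circle of radius \<open>w\<close> around \<open>B\<close> does not cross the line \<open>A Q\<close>, since the
  distance of this line from \<open>B\<close> is the altitude.
\<close>

lemma below_apex:
  assumes "A \<noteq> B" and Q: "dist A Q = dist A B" "dist Q B = dist A B"
    "orient B A Q = sqrt (2 * cosh (dist A B) + 1) * (cosh (dist A B) - 1)"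
    and c: "(cosh w)\<^sup>2 * (cosh (dist A B) + 1) \<le> 2 * (cosh (dist A B))\<^sup>2"
    and w: "0 \<le> w" "w \<le> dist A B"
  shows "dist B p = w \<Longrightarrow> 0 \<le> orient A Q p" and "dist A p = w \<Longrightarrow> 0 \<le> orient Q B p"
proof -
  define C where "C = cosh (dist A B)"
  have C: "1 < C" unfolding C_def using assms(1) cosh_real_nonneg_less_iff[of 0 "dist A B"] by simp
  have cC: "cosh w \<le> C" unfolding C_def using w by (subst cosh_real_nonneg_le_iff) simp_all
  have m: "mink (hvec A) (hvec B) = - C" "mink (hvec B) (hvec A) = - C"
    "mink (hvec Q) (hvec B) = - C" "mink (hvec B) (hvec Q) = - C"
    "mink (hvec Q) (hvec A) = - C" "mink (hvec A) (hvec Q) = - C"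
    using Q by (simp_all add: mink_dist C_def dist_commute)
  have C2: "0 < C * C - 1" using C by (simp add: less_1_mult)
  define K where "K = sqrt (2 * C + 1) * (C - 1)"
  have K: "orient B A Q = K" unfolding K_def C_def by (rule Q(3))
  note T = tdet_angle[OF mink_hvec_self]
  have q: "0 \<le> C * cosh x - cosh w" for x :: real
  proof -
    have "C * 1 \<le> C * cosh x" using C by (intro mult_left_mono cosh_real_ge_1) simp
    then show ?thesis using cC by linarith
  qed
  { assume p: "dist B p = w"
    define \<alpha> s where "\<alpha> = cosh (dist A p)" and "s = orient B A p"
    have mp: "mink (hvec p) (hvec B) = - cosh w" "mink (hvec A) (hvec p) = - \<alpha>"
      "mink (hvec B) (hvec p) = - cosh w"
      using p by (simp_all add: mink_dist \<alpha>_def dist_commute)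
    have "s\<^sup>2 = 1 + 2 * C * \<alpha> * cosh w - C\<^sup>2 - \<alpha>\<^sup>2 - (cosh w)\<^sup>2"
      unfolding s_def orient_square m mp by (simp add: algebra_simps)
    then have "s * (C\<^sup>2 - C) \<le> K * (C * \<alpha> - cosh w)"
      unfolding K_def by (intro below_apex_numeric[OF C c[folded C_def]]) (use q in \<open>simp_all add: \<alpha>_def\<close>)
    moreover have "orient A p B = s" "orient A Q B = K"
      using K orient_rotate[of B A p] orient_rotate[of B A Q] unfolding s_def by simp_all
    then have "orient A Q p * (C * C - 1) = K * (C * \<alpha> - cosh w) - s * (C * C - C)"
      using T[of A "hvec Q" "hvec p" "hvec B"] unfolding orient_tdet[symmetric] m mp mink_hvec_self
      by (simp add: algebra_simps)
    ultimately have "0 \<le> orient A Q p * (C * C - 1)" by (simp add: power2_eq_square)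
    then show "0 \<le> orient A Q p" using C2 by (simp add: zero_le_mult_iff) }
  { assume p: "dist A p = w"
    define \<alpha> s where "\<alpha> = cosh (dist B p)" and "s = orient B A p"
    have mp: "mink (hvec p) (hvec A) = - cosh w" "mink (hvec B) (hvec p) = - \<alpha>"
      "mink (hvec A) (hvec p) = - cosh w"
      using p by (simp_all add: mink_dist \<alpha>_def dist_commute)
    have "s\<^sup>2 = 1 + 2 * C * \<alpha> * cosh w - C\<^sup>2 - \<alpha>\<^sup>2 - (cosh w)\<^sup>2"
      unfolding s_def orient_square m mp by (simp add: algebra_simps)
    then have "s * (C\<^sup>2 - C) \<le> K * (C * \<alpha> - cosh w)"
      unfolding K_def by (intro below_apex_numeric[OF C c[folded C_def]]) (use q in \<open>simp_all add: \<alpha>_def\<close>)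
    moreover have "orient B p A = - s" "orient B Q A = - K"
      "orient B p Q = orient Q B p"
      using K orient_rotate[of Q B p] orient_swap[of B A p] orient_swap[of B A Q]
        orient_rotate[of A B p] orient_rotate[of A B Q] unfolding s_def by simp_all
    then have "orient Q B p * (C * C - 1) = K * (C * \<alpha> - cosh w) - s * (C * C - C)"
      using T[of B "hvec p" "hvec Q" "hvec A"] unfolding orient_tdet[symmetric] m mp mink_hvec_self
      by (simp add: algebra_simps)
    ultimately have "0 \<le> orient Q B p * (C * C - 1)" by (simp add: power2_eq_square)
    then show "0 \<le> orient Q B p" using C2 by (simp add: zero_le_mult_iff) }
qed

section \<open>Cyclic polygons with equal altitudes\<close>

text \<open>
  An ordinary reduced polygon with vertices \<open>V a\<close> and feet \<open>T a\<close> of their altitudes. The indices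
  run periodically through all natural numbers, so that an interval of indices can pass the
  vertex of index \<open>0\<close>; any \<open>n\<close> consecutive indices number the vertices in positive orientation.
\<close>

locale altitude_star =
  fixes V T :: "nat \<Rightarrow> hyp" and m n :: nat and w :: real
  assumes n: "n = 2 * m + 1" and m: "1 \<le> m" and w: "0 < w"
    and V_periodic: "V (a + n) = V a" and T_periodic: "T (a + n) = T a"
    and convex: "\<lbrakk>a < b; b < c; c < a + n\<rbrakk> \<Longrightarrow> 0 < orient (V a) (V b) (V c)"
    and foot: "T a \<in> relint_hseg (V (a + m)) (V (a + m + 1))"
    and orth: "is_orth_proj (V a) (hline (V (a + m)) (V (a + m + 1))) (T a)"
    and height: "dist (V a) (T a) = w"

begin

lemma weakly_convex:
  assumes "a \<le> b" "b \<le> c" "c \<le> a + n"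
  shows "0 \<le> orient (V a) (V b) (V c)"
proof -
  consider "a = b" | "b = c" | "c = a + n" | "a < b" "b < c" "c < a + n" using assms by linarith
  then show ?thesis
    by cases (simp_all add: orient_same V_periodic convex less_imp_le)
qed

lemma V_neq:
  assumes "a < b" "b < a + n"
  shows "V a \<noteq> V b"
proof
  assume *: "V a = V b"
  show False
  proof (cases "Suc b < a + n")
    case True
    then show False using convex[of a b "Suc b"] * assms by (simp add: orient_same)
  next
    case False
    then have "a < Suc a" "Suc a < b" using assms m n by auto
    then show False using convex[of a "Suc a" b] * assms by (simp add: orient_same)
  qed
qed

lemma foot_combination:
  obtains s t where "0 < s" "0 < t" "hvec (T a) = s *\<^sub>R hvec (V (a + m)) + t *\<^sub>R hvec (V (a + m + 1))"
proof -
  have "V (a + m) \<noteq> V (a + m + 1)" using m n by (intro V_neq) auto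
  moreover have "T a \<in> hseg (V (a + m)) (V (a + m + 1))" "T a \<noteq> V (a + m)" "T a \<noteq> V (a + m + 1)"
    using foot[of a] by (auto simp: relint_hseg_def)
  ultimately show thesis using that hseg_combination[of "T a" "V (a + m)" "V (a + m + 1)"] by metis
qed

lemma cosh_star_edge: "cosh (dist (V a) (V (a + m))) = cosh w * cosh (dist (T a) (V (a + m)))"
  "cosh (dist (V a) (V (a + m + 1))) = cosh w * cosh (dist (T a) (V (a + m + 1)))"
  using cosh_dist_foot[OF orth endpoints_in_hline(1)] cosh_dist_foot[OF orth endpoints_in_hline(2)]
  by (simp_all add: height)

lemma wrap:
  "V (a + m + 1 + m) = V a" "V (a + m + 1 + m + 1) = V (Suc a)" "T (a + m + 1 + m + 1) = T (Suc a)"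
proof -
  have e: "a + m + 1 + m = a + n" "a + m + 1 + m + 1 = Suc a + n" using n by simp_all
  show "V (a + m + 1 + m) = V a" unfolding e(1) by (rule V_periodic)
  show "V (a + m + 1 + m + 1) = V (Suc a)" "T (a + m + 1 + m + 1) = T (Suc a)"
    unfolding e(2) by (rule V_periodic T_periodic)+
qed

text \<open>
  The foot \<open>T a\<close> divides its side into two arms; this is the one before the foot.
\<close>

definition arm :: "nat \<Rightarrow> real" where
  "arm a = dist (T a) (V (a + m))"

lemma arm_wrap: "arm (a + m + 1 + m + 1) = arm (Suc a)"
proof -
  have "a + m + 1 + m + 1 + m = Suc a + m + n" using n by simp
  then have "V (a + m + 1 + m + 1 + m) = V (Suc a + m)" by (simp only: V_periodic)
  then show ?thesis unfolding arm_def wrap by simp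
qed

text \<open>
  The right triangles \<open>V a, T a, V (a + m + 1)\<close> and \<open>V (a + m + 1), T (a + m + 1), V a\<close> have a
  common hypotenuse and legs of length \<open>w\<close>, so their remaining legs are equal.
\<close>

lemma other_arm: "dist (T a) (V (a + m + 1)) = arm (a + m + 1)"
proof -
  have "cosh (dist (V (a + m + 1)) (V a)) = cosh w * cosh (arm (a + m + 1))"
    using cosh_star_edge(1)[of "a + m + 1"] unfolding arm_def wrap .
  then have "cosh w * cosh (dist (T a) (V (a + m + 1))) = cosh w * cosh (arm (a + m + 1))"
    using cosh_star_edge(2)[of a] by (simp add: dist_commute)
  then show ?thesis by (intro dist_eqI) (simp_all add: arm_def)
qed

lemma side: "dist (V a) (V (Suc a)) = arm (a + m + 1) + arm (Suc a)"
proof -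
  have "T (a + m + 1) \<in> hseg (V a) (V (Suc a))"
    using foot[of "a + m + 1"] unfolding relint_hseg_def wrap by simp
  then have "dist (V a) (V (Suc a)) = dist (V a) (T (a + m + 1)) + dist (T (a + m + 1)) (V (Suc a))"
    by (simp add: hseg_def)
  also have "dist (V a) (T (a + m + 1)) = arm (a + m + 1)"
    unfolding arm_def wrap by (rule dist_commute)
  also have "dist (T (a + m + 1)) (V (Suc a)) = arm (Suc a)"
    using other_arm[of "a + m + 1"] unfolding wrap arm_wrap .
  finally show ?thesis .
qed

text \<open>
  Every side consists of two arms, and every arm length occurs in two sides. Both lengths below
  are sums of the arms of the indices \<open>a + 1, \<dots>, k\<close> and \<open>a + m + 1, \<dots>, k + m\<close>: the sides between
  \<open>V a\<close> and \<open>V k\<close>, and the opposite part of the boundary, cut off at the feet, are equally long.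
\<close>

lemma chain_between_feet:
  assumes "a < k"
  shows "chain_length (T a) (map V [a + m + 1..<k + m + 1]) (T k) = (\<Sum>l=a..<k. dist (V l) (V (Suc l)))"
proof -
  have "(\<Sum>l=a + m + 1..<k + m. dist (V l) (V (Suc l))) = (\<Sum>l=a..<k - 1. arm (Suc l) + arm (l + m + 2))"
  proof -
    have "(\<Sum>l=a + m + 1..<k + m. dist (V l) (V (Suc l))) =
        (\<Sum>l=a..<k - 1. dist (V (l + (m + 1))) (V (Suc (l + (m + 1)))))"
      using sum.shift_bounds_nat_ivl[of "\<lambda>l. dist (V l) (V (Suc l))" a "m + 1" "k - 1"] assms by simp
    also have "\<dots> = (\<Sum>l=a..<k - 1. arm (Suc l) + arm (l + m + 2))"
    proof (rule sum.cong[OF refl])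
      fix l
      show "dist (V (l + (m + 1))) (V (Suc (l + (m + 1)))) = arm (Suc l) + arm (l + m + 2)"
        unfolding side using arm_wrap[of l] by simp
    qed
    finally show ?thesis .
  qed
  moreover have "chain_length (T a) (map V [a + m + 1..<k + m + 1]) (T k) =
      arm (a + m + 1) + (\<Sum>l=a + m + 1..<k + m. dist (V l) (V (Suc l))) + arm k"
    using chain_length_upt[of "a + m + 1" "k + m" "T a" V "T k"] other_arm[of a] assms
    by (simp add: arm_def dist_commute)
  moreover have "(\<Sum>l=a..<k. dist (V l) (V (Suc l))) = (\<Sum>l=a..<k. arm (Suc l)) + (\<Sum>l=a..<k. arm (l + m + 1))"
    unfolding side by (simp add: sum.distrib)
  moreover have "(\<Sum>l=a..<k. arm (Suc l)) = (\<Sum>l=a..<k - 1. arm (Suc l)) + arm k"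
    using assms by (cases k) simp_all
  moreover have "(\<Sum>l=a..<k. arm (l + m + 1)) = arm (a + m + 1) + (\<Sum>l=a..<k - 1. arm (l + m + 2))"
    using assms sum.shift_bounds_Suc_ivl[of "\<lambda>l. arm (l + m + 1)" a "k - 1"]
    by (simp add: sum.atLeast_Suc_lessThan)
  ultimately show ?thesis by (simp add: sum.distrib)
qed

text \<open>
  For \<open>x\<close> on the inner side of the side opposite to \<open>V a\<close>, the angle at \<open>T a\<close> between \<open>V a\<close> and
  \<open>x\<close> is not obtuse, so the theorem of Pythagoras becomes an inequality.
\<close>

lemma cosh_chord_le:
  assumes "0 \<le> orient (V (a + m)) (V (a + m + 1)) x"
  shows "cosh (dist (V a) x) \<le> cosh w * cosh (dist (T a) x)"
    and "0 < orient (V (a + m)) (V (a + m + 1)) x \<Longrightarrow> cosh (dist (V a) x) < cosh w * cosh (dist (T a) x)"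
proof -
  have "0 < orient (V a) (V (a + m)) (V (a + m + 1))" using m n by (intro convex) auto
  then have p: "0 < orient (V (a + m)) (V (a + m + 1)) (V a)"
    using orient_rotate[of "V a"] by simp
  have "1 < cosh w" using w cosh_real_nonneg_less_iff[of 0 w] by simp
  then have c: "0 < (cosh w)\<^sup>2 - 1" by (simp add: power2_eq_square less_1_mult)
  note o = orient_foot[OF orth[of a], of x, unfolded height]
  have "0 \<le> orient (V (a + m)) (V (a + m + 1)) x * ((cosh w)\<^sup>2 - 1)" using assms c by simp
  then have "0 \<le> cosh w * cosh (dist (T a) x) - cosh (dist (V a) x)"
    unfolding o using p by (simp add: zero_le_mult_iff)
  then show "cosh (dist (V a) x) \<le> cosh w * cosh (dist (T a) x)" by simp
  assume "0 < orient (V (a + m)) (V (a + m + 1)) x"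
  then have "0 < orient (V (a + m)) (V (a + m + 1)) x * ((cosh w)\<^sup>2 - 1)" using c by simp
  then have "0 < cosh w * cosh (dist (T a) x) - cosh (dist (V a) x)"
    unfolding o using p by (simp add: zero_less_mult_iff)
  then show "cosh (dist (V a) x) < cosh w * cosh (dist (T a) x)" by simp
qed

text \<open>
  If \<open>w\<close> is at most the altitude of the equilateral triangle \<open>A B Q\<close> over \<open>A = V k\<close>, \<open>B = V a\<close>,
  then the convex chain \<open>A, T a, V (a + m + 1), \<dots>, V (k + m), T k, B\<close> lies in this triangle:
  near \<open>A\<close> it is bounded by the ray from \<open>A\<close> to \<open>T a\<close>, near \<open>B\<close> by the ray from \<open>B\<close> to \<open>T k\<close>,
  and both rays lie below the legs of the triangle. So it is not longer than the two legs
  together.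
\<close>

lemma chain_within_equilateral:
  assumes ak: "a < k" "k \<le> a + m"
    and c: "cosh w * cosh (dist (V k) (V a) / 2) \<le> cosh (dist (V k) (V a))"
  shows "dist (V k) (T a) + (\<Sum>l=a..<k. dist (V l) (V (Suc l))) + dist (T k) (V a)
    \<le> 2 * dist (V k) (V a)"
proof -
  define A B d where "A = V k" and "B = V a" and "d = dist A B"
  have "A \<noteq> B" using V_neq[of a k] ak n unfolding A_def B_def by auto
  have wd: "w \<le> d"
  proof -
    have "cosh w * 1 \<le> cosh w * cosh (d / 2)" by (intro mult_left_mono cosh_real_ge_1) simp
    then have "cosh w \<le> cosh d" using c unfolding d_def A_def B_def by linarith
    then show ?thesis using w by (simp add: cosh_real_nonneg_le_iff d_def)
  qed
  have c2: "(cosh w)\<^sup>2 * (cosh d + 1) \<le> 2 * (cosh d)\<^sup>2"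
  proof -
    have "(cosh w * cosh (d / 2))\<^sup>2 \<le> (cosh d)\<^sup>2"
      using c unfolding d_def A_def B_def by (intro power_mono) simp_all
    moreover have "cosh d + 1 = 2 * (cosh (d / 2))\<^sup>2"
      using cosh_double_cosh[of "d / 2"] by simp
    ultimately show ?thesis by (simp add: power_mult_distrib)
  qed
  obtain Q where Q: "dist A Q = dist A B" "dist Q B = dist A B"
    "orient B A Q = sqrt (2 * cosh (dist A B) + 1) * (cosh (dist A B) - 1)"
    using equilateral_apex[OF \<open>A \<noteq> B\<close>] .
  \<comment> \<open>Both feet lie below the legs of the equilateral triangle.\<close>
  note below = below_apex[OF \<open>A \<noteq> B\<close> Q c2[unfolded d_def] less_imp_le[OF w] wd[unfolded d_def]]
  have QTa: "0 \<le> orient A Q (T a)" by (rule below(1)) (simp add: B_def height)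
  have QTk: "0 \<le> orient Q B (T k)" by (rule below(2)) (simp add: A_def height)
  have "1 < cosh (dist A B)" using \<open>A \<noteq> B\<close> cosh_real_nonneg_less_iff[of 0 "dist A B"] by simp
  then have Qpos: "0 < orient A Q B" unfolding orient_rotate[of B A Q, symmetric] Q(3) by simp
  obtain s t where st: "0 < s" "0 < t" "hvec (T a) = s *\<^sub>R hvec (V (a + m)) + t *\<^sub>R hvec (V (a + m + 1))"
    by (rule foot_combination)
  obtain s' t' where st': "0 < s'" "0 < t'" "hvec (T k) = s' *\<^sub>R hvec (V (k + m)) + t' *\<^sub>R hvec (V (k + m + 1))"
    by (rule foot_combination)
  have Ta: "orient (T a) x y = s * orient (V (a + m)) x y + t * orient (V (a + m + 1)) x y"
    "orient x (T a) y = s * orient x (V (a + m)) y + t * orient x (V (a + m + 1)) y" for x y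
    by (simp_all add: orient_tdet st tdet_linear)
  have Tk: "orient x (T k) y = s' * orient x (V (k + m)) y + t' * orient x (V (k + m + 1)) y"
    "orient x y (T k) = s' * orient x y (V (k + m)) + t' * orient x y (V (k + m + 1))" for x y
    by (simp_all add: orient_tdet st' tdet_linear)
  \<comment> \<open>The order along the boundary is \<open>V k\<close>, \<open>V (a + m)\<close>, \<open>T a\<close>, \<open>V (a + m + 1)\<close>, \<open>V (k + m)\<close>, \<open>T k\<close>,
    \<open>V (k + m + 1)\<close>, \<open>V (a + n)\<close>, where consecutive vertices may coincide if no foot separates them. Since feet
    are positive combinations of their neighbours, all orientations follow from those of the vertices.\<close>
  have VB: "B = V (a + n)" by (simp add: B_def V_periodic)
  have P: "0 < orient (V i) (V j) (V l)" if "k \<le> i" "i < j" "j < l" "l \<le> a + n" for i j l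
    using that ak by (intro convex) auto
  have N: "0 \<le> orient (V i) (V j) (V l)" if "k \<le> i" "i \<le> j" "j \<le> l" "l \<le> a + n" for i j l
    using that ak by (intro weakly_convex) auto
  have R: "orient (T k) B q = orient q (T k) B" for q by (rule orient_rotate[symmetric])
  have TaB: "0 < orient A (T a) B"
    unfolding Ta A_def VB using ak n m st(1,2) by (intro add_nonneg_pos mult_nonneg_nonneg mult_pos_pos P N) auto
  have TaV: "0 \<le> orient A (T a) (V j)" if "a + m + 1 \<le> j" "j \<le> k + m" for j
    unfolding Ta A_def using that ak n m st(1,2) by (intro add_nonneg_nonneg mult_nonneg_nonneg N) auto
  have TaTk: "0 < orient A (T a) (T k)"
  proof -
    have "0 \<le> orient A (V (a + m)) (V (k + m))" "0 \<le> orient A (V (a + m)) (V (k + m + 1))"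
      "0 \<le> orient A (V (a + m + 1)) (V (k + m))" "0 < orient A (V (a + m + 1)) (V (k + m + 1))"
      unfolding A_def using ak n m by (auto intro!: P N)
    then have "0 \<le> orient A (V (a + m)) (T k)" "0 < orient A (V (a + m + 1)) (T k)"
      unfolding Tk using st' by (auto intro!: add_nonneg_nonneg add_nonneg_pos)
    then show ?thesis unfolding Ta using st by (auto intro!: add_nonneg_pos)
  qed
  have TaVV: "0 \<le> orient (T a) (V (a + m + 1)) (V j)" if "a + m + 1 \<le> j" "j \<le> k + m" for j
    unfolding Ta orient_same using that ak n m st(1,2) by (auto intro!: mult_nonneg_nonneg N)
  have VVTk: "0 < orient (V i) (V j) (T k)" if "k \<le> i" "i < j" "j \<le> k + m" for i j
    unfolding Tk using that ak n m st'(1,2)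
    by (intro add_nonneg_pos mult_nonneg_nonneg mult_pos_pos P N) auto
  have TaVTk: "0 < orient (T a) (V (a + m + 1)) (T k)"
    unfolding Ta orient_same using VVTk[of "a + m" "a + m + 1"] ak st by simp
  have VTkB: "0 \<le> orient (V j) (T k) B" if "k \<le> j" "j \<le> k + m" for j
    unfolding Tk VB using that ak n m st'(1,2) by (intro add_nonneg_nonneg mult_nonneg_nonneg N) auto
  have VTkB': "0 < orient (V j) (T k) B" if "k \<le> j" "j < k + m" for j
    unfolding Tk VB using that ak n m st'(1,2)
    by (intro add_pos_nonneg mult_nonneg_nonneg mult_pos_pos P N) auto
  have TaTkB: "0 < orient (T a) (T k) B"
    unfolding Ta using ak n m st(1,2)
    by (intro add_pos_nonneg mult_nonneg_nonneg mult_pos_pos VTkB VTkB') auto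
  have VB': "0 < orient A (V j) B" if "k < j" "j < a + n" for j
    unfolding A_def VB using that by (intro P) auto
  have TkB: "0 < orient A (T k) B"
    unfolding A_def using m by (intro VTkB') auto
  \<comment> \<open>All points to the left of the ray from \<open>A\<close> to \<open>T a\<close> are to the left of the ray to \<open>Q\<close>.\<close>
  have beyond: "orient A Q p * orient A (T a) B = orient A Q (T a) * orient A p B + orient A (T a) p * orient A Q B" for p
    unfolding orient_tdet by (rule pluecker)
  have QTk': "0 < orient A Q (T k)"
  proof -
    have "0 < orient A Q (T k) * orient A (T a) B" unfolding beyond
      using QTa TkB TaTk Qpos by (intro add_nonneg_pos mult_nonneg_nonneg mult_pos_pos) auto
    then show ?thesis using TaB by (simp add: zero_less_mult_iff)
  qed
  have QV: "0 \<le> orient A Q (V j)" if "a + m + 1 \<le> j" "j \<le> k + m" for j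
  proof -
    have "0 \<le> orient A Q (V j) * orient A (T a) B" unfolding beyond
      using QTa VB'[of j] TaV[of j] that ak n Qpos by (intro add_nonneg_nonneg mult_nonneg_nonneg) auto
    then show ?thesis using TaB by (simp add: zero_le_mult_iff)
  qed
  \<comment> \<open>The line from \<open>B\<close> through \<open>T k\<close> meets the leg \<open>A Q\<close> in \<open>Z\<close>. The chain from \<open>A\<close> to \<open>T k\<close> lies in
    the triangle \<open>A Z (T k)\<close>; only \<open>V (k + m)\<close>, the last vertex before \<open>T k\<close>, can lie on \<open>Z (T k)\<close>, and does so
    when \<open>k = a + m\<close>.\<close>
  have flip: "orient Q A x = - orient A Q x" for x by (rule orient_swap)
  have "0 < (-1) * orient Q A B" "0 < (-1) * orient B (T k) A" "0 \<le> (-1) * orient B Q (T k)"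
    using Qpos TkB QTk flip[of B] orient_swap[of Q B "T k"] orient_swap[of A B "T k"]
      orient_rotate[of A "T k" B] orient_swap[of B "T k" A] orient_rotate[of B "T k" A]
      orient_rotate[of "T k" A B] orient_rotate[of "T k" B A] by auto
  then obtain Z l u r where Z: "0 < l" "0 \<le> u" "hvec Z = l *\<^sub>R hvec Q + u *\<^sub>R hvec A"
    "0 < r" "hvec (T k) = r *\<^sub>R hvec Z + (orient Q A (T k) / orient Q A B) *\<^sub>R hvec B"
    by (rule cut_triangle)
  define b where "b = orient Q A (T k) / orient Q A B"
  have b: "0 < b" unfolding b_def flip using Qpos QTk' by simp
  have ZTk: "r * orient Z (T k) q = b * orient q (T k) B" for q
  proof -
    have "r *\<^sub>R hvec Z = hvec (T k) - b *\<^sub>R hvec B" using Z(5) by (simp add: b_def)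
    then have "r * orient Z (T k) q = tdet (hvec (T k) - b *\<^sub>R hvec B) (hvec (T k)) (hvec q)"
      unfolding orient_tdet by (metis tdet_linear(7))
    also have "\<dots> = b * orient (T k) B q"
      by (simp add: tdet_linear tdet_same orient_tdet tdet_swap[of "hvec (T k)"])
    finally show ?thesis unfolding R .
  qed
  have AZ: "orient A Z q = l * orient A Q q" for q
    by (simp add: orient_tdet Z(3) tdet_linear tdet_same)
  have ZTk_nonneg: "0 \<le> orient Z (T k) q" if "0 \<le> orient q (T k) B" for q
  proof -
    have "0 \<le> r * orient Z (T k) q" unfolding ZTk using that b by simp
    then show ?thesis using Z(4) by (simp add: zero_le_mult_iff)
  qed
  have ZTk_pos: "0 < orient Z (T k) q" if "0 < orient q (T k) B" for q
  proof -
    have "0 < r * orient Z (T k) q" unfolding ZTk using that b by simp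
    then show ?thesis using Z(4) by (simp add: zero_less_mult_iff)
  qed
  have d1: "dist Z (T k) + dist (T k) B = dist Z B"
    using Z b by (intro combination_hseg[OF _ _ Z(5)]) (simp_all add: b_def)
  have d2: "dist Q Z + dist Z A = dist Q A"
    using Z by (intro combination_hseg[OF _ _ Z(3)]) simp_all
  let ?ys = "map V [a + m + 1..<k + m + 1]"
  have ys: "[a + m + 1..<k + m + 1] = (a + m + 1) # [Suc (a + m + 1)..<Suc (k + m)]"
    "[a + m + 1..<k + m + 1] = [a + m + 1..<k + m] @ [k + m]"
    using ak by (simp_all add: upt_conv_Cons)
  have "left_chain (V (a + m + 1)) (map V [Suc (a + m + 1)..<Suc (k + m)]) (T k)"
    by (rule left_chain_upt) (use ak n in \<open>auto intro: less_imp_le[OF P] VVTk\<close>)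
  then have "left_chain (T a) ?ys (T k)"
    unfolding ys(1) using TaVV TaVTk by auto
  then have "left_chain A (T a # ?ys) (T k)"
    using TaV TaTk by auto
  then have "chain_length A (T a # ?ys) (T k) \<le> dist A Z + dist Z (T k)"
  proof (rule chain_length_le)
    show "0 < orient Z (T k) A" using TkB by (rule ZTk_pos)
    fix p assume p: "p \<in> set (T a # ?ys)"
    then show "0 \<le> orient A Z p" unfolding AZ using QTa QV Z(1) by auto
    show "0 \<le> orient Z (T k) p" using p TaTkB VTkB ak by (intro ZTk_nonneg) auto
  next
    fix p assume p: "p \<in> set (butlast (T a # ?ys))"
    show "0 < orient Z (T k) p"
      using p TaTkB VTkB' ak unfolding ys(2) by (intro ZTk_pos) auto
  qed
  then have "dist A (T a) + (\<Sum>l=a..<k. dist (V l) (V (Suc l))) \<le> dist A Z + dist Z (T k)"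
    using chain_between_feet[OF ak(1)] by simp
  then have "dist A (T a) + (\<Sum>l=a..<k. dist (V l) (V (Suc l))) + dist (T k) B \<le> dist A Z + dist Z B"
    using d1 by simp
  also have "\<dots> \<le> dist A Q + dist Q B" using dist_triangle[of Z B Q] d2 by (simp add: dist_commute)
  also have "\<dots> = 2 * dist A B" using Q by simp
  finally show ?thesis unfolding A_def B_def .
qed

lemma dist_less_path:
  assumes "Suc a < k" "k < a + n"
  shows "dist (V a) (V k) < (\<Sum>l=a..<k. dist (V l) (V (Suc l)))"
proof -
  have "dist (V a) (V k) \<noteq> dist (V a) (V (Suc a)) + dist (V (Suc a)) (V k)"
  proof
    assume "dist (V a) (V k) = dist (V a) (V (Suc a)) + dist (V (Suc a)) (V k)"
    then have "orient (V a) (V (Suc a)) (V k) = 0" by (intro orient_hseg) (simp add: hseg_def)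
    then show False using convex[of a "Suc a" k] assms by simp
  qed
  then have "dist (V a) (V k) < dist (V a) (V (Suc a)) + dist (V (Suc a)) (V k)"
    using dist_triangle[of "V a" "V k" "V (Suc a)"] by simp
  also have "\<dots> \<le> dist (V a) (V (Suc a)) + (\<Sum>l=Suc a..<k. dist (V l) (V (Suc l)))"
    using assms by (simp add: dist_le_path)
  also have "\<dots> = (\<Sum>l=a..<k. dist (V l) (V (Suc l)))"
    using assms by (simp add: sum.atLeast_Suc_lessThan[of a k])
  finally show ?thesis .
qed

text \<open>
  Assume the reverse inequality. The chain of length at most \<open>2 * d\<close> has end pieces of length at
  least \<open>d / 2\<close>, because the angles at the feet are not obtuse, and a middle part of length at
  least \<open>d\<close>, because it is as long as the chain of sides from \<open>V a\<close> to \<open>V k\<close>. So all these are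
  equalities: the chain of sides is straight, that is \<open>k = a + 1\<close>, and the angle at \<open>T a\<close> is
  right, that is \<open>k = a + m\<close>.
\<close>

lemma cosh_dist_vertices_le:
  assumes ak: "a < k" "k \<le> a + m"
  defines "d \<equiv> dist (V a) (V k)"
  shows "cosh d \<le> cosh w * cosh (d / 2)" and "cosh d = cosh w * cosh (d / 2) \<Longrightarrow> m = 1"
proof -
  have *: "cosh d = cosh w * cosh (d / 2) \<and> m = 1" if c: "cosh w * cosh (d / 2) \<le> cosh d"
  proof -
    define y z S where "y = dist (T a) (V k)" and "z = dist (T k) (V a)"
      and "S = (\<Sum>l=a..<k. dist (V l) (V (Suc l)))"
    have o: "orient (V (a + m)) (V (a + m + 1)) (V k) = orient (V k) (V (a + m)) (V (a + m + 1))"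
      by (rule orient_rotate[symmetric])
    have "0 \<le> orient (V k) (V (a + m)) (V (a + m + 1))"
      using ak n by (intro weakly_convex) auto
    then have y: "cosh d \<le> cosh w * cosh y"
      unfolding d_def y_def using cosh_chord_le(1)[of a "V k"] o by simp
    have y': "cosh d < cosh w * cosh y" if "k < a + m"
    proof -
      have "0 < orient (V k) (V (a + m)) (V (a + m + 1))"
        using ak n that by (intro convex) auto
      then show ?thesis
        unfolding d_def y_def using cosh_chord_le(2)[of a "V k"] o by simp
    qed
    have "0 \<le> orient (V (k + m)) (V (k + m + 1)) (V (a + n))"
      using ak n by (intro weakly_convex) auto
    then have z: "cosh d \<le> cosh w * cosh z"
      unfolding d_def z_def using cosh_chord_le(1)[of k "V a"] by (simp add: V_periodic dist_commute)
    have half: "d / 2 \<le> x" if "cosh d \<le> cosh w * cosh x" "0 \<le> x" for x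
    proof -
      have "cosh w * cosh (d / 2) \<le> cosh w * cosh x" using that(1) c by linarith
      then show ?thesis using that(2) by (simp add: cosh_real_nonneg_le_iff d_def)
    qed
    have yz: "d / 2 \<le> y" "d / 2 \<le> z" using half y z by (simp_all add: y_def z_def)
    have "y + S + z \<le> 2 * d"
      using chain_within_equilateral[OF ak] c unfolding d_def y_def z_def S_def
      by (simp add: dist_commute)
    moreover have "d \<le> S" unfolding d_def S_def using ak by (intro dist_le_path) simp
    ultimately have eq: "S = d" "y = d / 2" using yz by linarith+
    have "k = a + m" using y' c ak unfolding eq by force
    moreover have "\<not> Suc a < k" using dist_less_path[of a k] eq(1) ak n unfolding d_def S_def by auto
    ultimately have "m = 1" using ak by simp
    then show ?thesis using y c unfolding eq by simp
  qed
  show "cosh d \<le> cosh w * cosh (d / 2)" using * by linarith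
  show "cosh d = cosh w * cosh (d / 2) \<Longrightarrow> m = 1" using * by simp
qed

text \<open>
  In a triangle the lines \<open>V a, V (a + m)\<close> are the sides themselves. By Pythagoras a side is the
  longer, the longer its arm is, whereas it is the sum of the two other arms; so all arms are
  equal.
\<close>

lemma triangle_sides:
  assumes "m = 1"
  shows "dist (V a) (V (Suc a)) = dist (V b) (V (Suc b))"
    and "cosh (dist (V a) (V (Suc a))) = cosh w * cosh (dist (V a) (V (Suc a)) / 2)"
proof -
  have s: "dist (V a) (V (Suc a)) = arm (Suc (Suc a)) + arm (Suc a)" for a
    using side[of a] assms by simp
  have c: "cosh (dist (V a) (V (Suc a))) = cosh w * cosh (arm a)" for a
  proof -
    have "V (a + m) = V (Suc a)" using assms by simp
    then show ?thesis using cosh_star_edge(1)[of a] unfolding arm_def by simp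
  qed
  have p: "arm (Suc (Suc (Suc a))) = arm a" for a
  proof -
    have "a + n = Suc (Suc (Suc a))" "a + n + m = a + m + n" using n assms by simp_all
    then show ?thesis using V_periodic[of "a + m"] T_periodic[of a] unfolding arm_def by metis
  qed
  have mono: "arm x \<le> arm y \<longleftrightarrow> dist (V x) (V (Suc x)) \<le> dist (V y) (V (Suc y))" for x y
  proof -
    have "dist (V x) (V (Suc x)) \<le> dist (V y) (V (Suc y)) \<longleftrightarrow>
        cosh (dist (V x) (V (Suc x))) \<le> cosh (dist (V y) (V (Suc y)))"
      by (simp add: cosh_real_nonneg_le_iff)
    also have "\<dots> \<longleftrightarrow> arm x \<le> arm y" unfolding c by (simp add: cosh_real_nonneg_le_iff arm_def)
    finally show ?thesis by simp
  qed
  have "arm (Suc a) = arm a" for a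
    using mono[of a "Suc a"] unfolding s p by linarith
  then have e: "arm a = arm 0" for a by (induction a) simp_all
  show "dist (V a) (V (Suc a)) = dist (V b) (V (Suc b))" unfolding s e[of "Suc _"] ..
  show "cosh (dist (V a) (V (Suc a))) = cosh w * cosh (dist (V a) (V (Suc a)) / 2)"
    unfolding c unfolding s by (simp add: e[of "Suc _"] e[of a])
qed

end

section \<open>The diameter of a polygon\<close>

text \<open>
  In \<open>y = s * a + t * b\<close> the coefficients satisfy \<open>s + t \<le> 1\<close>, so \<open>cosh (dist x y)\<close>, which is
  linear in \<open>y\<close>, is at most the larger of its values at \<open>a\<close> and \<open>b\<close>.
\<close>

lemma hconvex_cball: "hconvex {y. dist x y \<le> r}"
  unfolding hconvex_def
proof (intro ballI subsetI)
  fix a b y assume a: "a \<in> {y. dist x y \<le> r}" and b: "b \<in> {y. dist x y \<le> r}" and y: "y \<in> hseg a b"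
  show "y \<in> {y. dist x y \<le> r}"
  proof (cases "a = b")
    case True
    then show ?thesis using y a by (simp add: hseg_def dist_commute)
  next
    case False
    obtain s t where st: "0 \<le> s" "0 \<le> t" "hvec y = s *\<^sub>R hvec a + t *\<^sub>R hvec b"
      using hseg_combination[OF y False] by metis
    have r: "0 \<le> r" using a order_trans[OF zero_le_dist, of x a r] by simp
    have "s * s + t * t + 2 * (s * t * cosh (dist a b)) = 1"
      using mink_hvec_self[of y] unfolding st(3) mink_linear mink_hvec_self
      by (simp add: mink_dist dist_commute algebra_simps)
    moreover have "s * t * 1 \<le> s * t * cosh (dist a b)"
      using st by (intro mult_left_mono cosh_real_ge_1) simp
    ultimately have "(s + t)\<^sup>2 \<le> 1" by (simp add: power2_eq_square algebra_simps)
    then have s1: "s + t \<le> 1" by (metis abs_le_square_iff abs_of_nonneg add_nonneg_nonneg one_power2 abs_one st(1,2))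
    have ab: "cosh (dist x a) \<le> cosh r" "cosh (dist x b) \<le> cosh r"
      using a b r by (simp_all add: cosh_real_nonneg_le_iff)
    have "cosh (dist x y) = s * cosh (dist x a) + t * cosh (dist x b)"
      unfolding cosh_dist st(3) mink_linear by simp
    also have "\<dots> \<le> s * cosh r + t * cosh r"
      using ab st by (intro add_mono mult_left_mono) simp_all
    also have "\<dots> \<le> 1 * cosh r" unfolding distrib_right[symmetric]
      using s1 by (intro mult_right_mono) simp_all
    finally show ?thesis using r by (simp add: cosh_real_nonneg_le_iff)
  qed
qed

text \<open>
  In a generating set with the least number of points no point can be omitted, so all its points
  are vertices.
\<close>

lemma hpolygon_hull_vertices:
  assumes "hpolygon P"
  shows "P \<subseteq> hconvex hull (hvertices P)"
proof -
  obtain S where S: "finite S \<and> P = hconvex hull S"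
    "\<And>S'. finite S' \<and> P = hconvex hull S' \<Longrightarrow> card S \<le> card S'"
    using assms ex_has_least_nat[of "\<lambda>S. finite S \<and> P = hconvex hull S" _ card]
    unfolding hpolygon_def by metis
  have "S \<subseteq> hvertices P"
  proof
    fix v assume v: "v \<in> S"
    have "v \<notin> hconvex hull (S - {v})"
    proof
      assume "v \<in> hconvex hull (S - {v})"
      then have "hconvex hull (insert v (S - {v})) = hconvex hull (S - {v})" by (rule hull_redundant)
      then have "card S \<le> card (S - {v})" using S v by (intro S(2)) (simp add: insert_absorb)
      then show False using S(1) v by (metis card_Diff1_less not_le)
    qed
    then show "v \<in> hvertices P" using S(1) v unfolding hvertices_def by blast
  qed
  then show ?thesis using S(1) hull_mono[of S "hvertices P" hconvex] by simp
qed

lemma hvertices_subset: "hvertices P \<subseteq> P"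
  unfolding hvertices_def using hull_subset[of _ hconvex] by blast

text \<open>
  Balls are convex, so a ball around any point contains the polygon as soon as it contains the
  vertices. This is applied first to the vertices and then to all points of the polygon as
  centres.
\<close>

lemma hpolygon_diameter_le:
  assumes "hpolygon P" "\<And>x y. x \<in> hvertices P \<Longrightarrow> y \<in> hvertices P \<Longrightarrow> dist x y \<le> D"
  shows "diameter P \<le> D"
proof -
  have 1: "dist x y \<le> D" if "\<And>u. u \<in> hvertices P \<Longrightarrow> dist x u \<le> D" "y \<in> P" for x y
  proof -
    have "hconvex hull (hvertices P) \<subseteq> {y. dist x y \<le> D}"
      using that(1) by (intro hull_minimal hconvex_cball) auto
    then show ?thesis using hpolygon_hull_vertices[OF assms(1)] that(2) by auto
  qed
  have "dist x y \<le> D" if "x \<in> P" "y \<in> P" for x y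
    using 1[of x y] 1[of _ x] assms(2) that by (metis dist_commute)
  moreover have "P \<noteq> {}"
    using assms(1) interior_subset[of P] unfolding hpolygon_def hconvex_body_def by auto
  ultimately show ?thesis unfolding diameter_def by (auto intro!: cSUP_least)
qed

section \<open>Ordinary reduced polygons\<close>

lemma altitude_star_of_polygon:
  assumes "0 < w" "minimal_width P = w" "ordinary_reduced_polygon P"
  obtains v m T where "altitude_star (\<lambda>a. v (a mod (2 * m + 1))) T m (2 * m + 1) w"
    "ngon_with_vertices P (2 * m + 1) v"
proof -
  obtain n v where n: "3 \<le> n" "odd n" and ngon: "ngon_with_vertices P n v"
    and feet: "\<forall>i<n.
      infdist (v i) (hseg (v ((i + (n - 1) div 2) mod n)) (v ((i + (n + 1) div 2) mod n))) = w \<and>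
      (\<exists>q\<in>relint_hseg (v ((i + (n - 1) div 2) mod n)) (v ((i + (n + 1) div 2) mod n)).
        is_orth_proj (v i) (hline (v ((i + (n - 1) div 2) mod n)) (v ((i + (n + 1) div 2) mod n))) q)"
    using assms(3) unfolding ordinary_reduced_polygon_def Let_def assms(2) by blast
  obtain m where m: "n = 2 * m + 1" using n(2) by (rule oddE)
  define V where "V a = v (a mod n)" for a
  have half: "(n - 1) div 2 = m" "(n + 1) div 2 = m + 1" using m by simp_all
  have "\<exists>q. q \<in> relint_hseg (V (i + m)) (V (i + m + 1)) \<and>
      is_orth_proj (V i) (hline (V (i + m)) (V (i + m + 1))) q \<and> dist (V i) q = w" if i: "i < n" for i
  proof -
    obtain q where q: "q \<in> relint_hseg (V (i + m)) (V (i + m + 1))"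
      "is_orth_proj (V i) (hline (V (i + m)) (V (i + m + 1))) q"
      using feet[rule_format, OF i] i unfolding half V_def by (auto simp: add.assoc)
    moreover have "infdist (V i) (hseg (V (i + m)) (V (i + m + 1))) = w"
      using feet[rule_format, OF i] i unfolding half V_def by (simp add: add.assoc)
    ultimately show ?thesis using infdist_hseg_foot[OF q(2,1)] by auto
  qed
  then obtain q where q: "\<And>i. i < n \<Longrightarrow> q i \<in> relint_hseg (V (i + m)) (V (i + m + 1))"
    "\<And>i. i < n \<Longrightarrow> is_orth_proj (V i) (hline (V (i + m)) (V (i + m + 1))) (q i)"
    "\<And>i. i < n \<Longrightarrow> dist (V i) (q i) = w" by metis
  define T where "T a = q (a mod n)" for a
  have Vmod: "V (a mod n + b) = V (a + b)" for a b
    unfolding V_def by (simp add: mod_add_left_eq)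
  have convex: "0 < orient (v i) (v j) (v k)" if "i < j" "j < k" "k < n" for i j k
    using ngon that unfolding ngon_with_vertices_def by blast
  have "altitude_star V T m n w"
  proof
    show "n = 2 * m + 1" "1 \<le> m" "0 < w" using m n assms by simp_all
    show "V (a + n) = V a" "T (a + n) = T a" for a by (simp_all add: V_def T_def)
    fix a
    have an: "a mod n < n" using n by simp
    show "T a \<in> relint_hseg (V (a + m)) (V (a + m + 1))"
      using q(1)[OF an] Vmod[of a m] Vmod[of a "m + 1"] by (simp add: T_def add.assoc)
    show "is_orth_proj (V a) (hline (V (a + m)) (V (a + m + 1))) (T a)"
      using q(2)[OF an] Vmod[of a m] Vmod[of a "m + 1"] Vmod[of a 0] by (simp add: T_def add.assoc)
    show "dist (V a) (T a) = w" using q(3)[OF an] Vmod[of a 0] by (simp add: T_def)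
    fix b c assume abc: "a < b" "b < c" "c < a + n"
    \<comment> \<open>Shifting all indices by a multiple of \<open>n\<close> brings \<open>a\<close> below \<open>n\<close>; then \<open>b\<close> and \<open>c\<close> wrap around at most once.\<close>
    define i j k where "i = a mod n" and "j = b - (a - a mod n)" and "k = c - (a - a mod n)"
    have le: "a mod n \<le> a" by simp
    have ijk: "i < j" "j < k" "k < i + n" "i < n" using abc le an unfolding i_def j_def k_def by linarith+
    have "a - a mod n = n * (a div n)" by (simp add: minus_mod_eq_mult_div)
    then have "b = j + n * (a div n)" "c = k + n * (a div n)"
      using abc le unfolding j_def k_def by linarith+
    then have V: "V a = v (i mod n)" "V b = v (j mod n)" "V c = v (k mod n)"
      unfolding V_def i_def by simp_all
    have im: "i mod n = i" using ijk by simp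
    have sub: "x mod n = x - n" if "n \<le> x" "x < i + n" for x
      using that ijk by (simp add: mod_if)
    consider "k < n" | "j < n" "n \<le> k" | "n \<le> j" by linarith
    then show "0 < orient (V a) (V b) (V c)"
    proof cases
      case 1
      then show ?thesis using convex[of i j k] ijk by (simp add: V)
    next
      case 2
      have "0 < orient (v (k - n)) (v i) (v j)" using 2 ijk by (intro convex) auto
      moreover have "k mod n = k - n" "j mod n = j" using 2 ijk sub by auto
      ultimately show ?thesis using orient_rotate[of "v (k - n)" "v i" "v j"] by (simp add: V im)
    next
      case 3
      have "0 < orient (v (j - n)) (v (k - n)) (v i)" using 3 ijk by (intro convex) auto
      moreover have "k mod n = k - n" "j mod n = j - n" using 3 ijk sub by auto
      ultimately show ?thesis
        using orient_rotate[of "v i" "v (j - n)" "v (k - n)"] by (simp add: V im)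
    qed
  qed
  then show thesis using that ngon unfolding V_def m by blast
qed

lemma equilateral_triangle_regular:
  assumes ngon: "ngon_with_vertices P 3 v"
    and d: "dist (v 0) (v 1) = d" "dist (v 1) (v 2) = d" "dist (v 2) (v 0) = d"
  shows "regular_triangle P"
  unfolding regular_ngon_def
proof (intro exI conjI)
  show "ngon_with_vertices P 3 v" by (rule ngon)
  have D: "dist (v 0) (v 1) = d" "dist (v 1) (v 2) = d" "dist (v 2) (v 0) = d"
    "dist (v 1) (v 0) = d" "dist (v 2) (v 1) = d" "dist (v 0) (v 2) = d"
    using d by (simp_all add: dist_commute)
  have cases3: "X 0 \<Longrightarrow> X 1 \<Longrightarrow> X 2 \<Longrightarrow> i < 3 \<Longrightarrow> X i" for X and i :: nat
  proof -
    assume X: "X 0" "X 1" "X 2" and "i < 3"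
    then have "i = 0 \<or> i = 1 \<or> i = 2" by linarith
    then show "X i" using X by (elim disjE) simp_all
  qed
  have m: "(0 + 1) mod 3 = (1::nat)" "(1 + 1) mod 3 = (2::nat)" "(2 + 1) mod 3 = (0::nat)"
    "(0 + 3 - 1) mod 3 = (2::nat)" "(1 + 3 - 1) mod 3 = (0::nat)" "(2 + 3 - 1) mod 3 = (1::nat)"
    by simp_all
  have "dist (v i) (v ((i + 1) mod 3)) = d" if "i < 3" for i
    by (rule cases3[OF _ _ _ that]) (simp_all only: m D)
  then show "\<forall>i<3. \<forall>j<3. dist (v i) (v ((i + 1) mod 3)) = dist (v j) (v ((j + 1) mod 3))"
    by simp
  have "hangle (v ((i + 3 - 1) mod 3)) (v i) (v ((i + 1) mod 3)) =
      arccos ((cosh d * cosh d - cosh d) / (sqrt ((cosh d)\<^sup>2 - 1) * sqrt ((cosh d)\<^sup>2 - 1)))"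
    if "i < 3" for i
    unfolding hangle_cosh by (rule cases3[OF _ _ _ that]) (simp_all only: m D)
  then show "\<forall>i<3. \<forall>j<3. hangle (v ((i + 3 - 1) mod 3)) (v i) (v ((i + 1) mod 3)) =
      hangle (v ((j + 3 - 1) mod 3)) (v j) (v ((j + 1) mod 3))"
    by simp
qed

text \<open>
  The number \<open>cosh (b / 2)\<close> is the positive root of \<open>2 * x\<^sup>2 - c * x - 1\<close>, and
  \<open>cosh d = 2 * (cosh (d / 2))\<^sup>2 - 1\<close>.
\<close>

lemma cosh_le_half_iff:
  fixes d c :: real
  assumes "0 \<le> d" "1 \<le> c"
  defines "b \<equiv> 2 * arcosh ((c + sqrt (c\<^sup>2 + 8)) / 4)"
  shows "cosh d \<le> c * cosh (d / 2) \<longleftrightarrow> d \<le> b" and "cosh d = c * cosh (d / 2) \<longleftrightarrow> d = b"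
proof -
  define r x x0 where "r = sqrt (c\<^sup>2 + 8)" and "x = cosh (d / 2)" and "x0 = (c + r) / 4"
  have r: "r * r = c * c + 8" by (simp add: r_def power2_eq_square)
  have "c \<le> r" unfolding r_def by (rule real_le_rsqrt) simp
  have "1 \<le> c * c" using assms(2) mult_mono[of 1 c 1 c] by simp
  then have "3 \<le> r" unfolding r_def by (intro real_le_rsqrt) (simp add: power2_eq_square)
  then have x0: "1 \<le> x0" using assms(2) by (simp add: x0_def)
  have x: "1 \<le> x" by (simp add: x_def cosh_real_ge_1)
  have "cosh d = 2 * x * x - 1"
    using cosh_double_cosh[of "d / 2"] by (simp add: x_def power2_eq_square)
  then have e: "c * x - cosh d = (x0 - x) * (2 * x + (r - c) / 2)"
    using r by (simp add: x0_def field_simps)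
  have "0 \<le> (r - c) / 2" using \<open>c \<le> r\<close> by simp
  then have p: "0 < 2 * x + (r - c) / 2" using x by linarith
  have "cosh d \<le> c * x \<longleftrightarrow> 0 \<le> c * x - cosh d" "cosh d = c * x \<longleftrightarrow> c * x - cosh d = 0" by auto
  then have 1: "cosh d \<le> c * x \<longleftrightarrow> x \<le> x0" "cosh d = c * x \<longleftrightarrow> x = x0"
    unfolding e using p by (auto simp: zero_le_mult_iff)
  have b: "x0 = cosh (b / 2)" "0 \<le> b"
    using x0 by (simp_all add: b_def x0_def r_def cosh_arcosh_real arcosh_nonneg_real)
  have 2: "cosh (d / 2) \<le> cosh (b / 2) \<longleftrightarrow> d \<le> b"
    using assms(1) b(2) by (simp add: cosh_real_nonneg_le_iff)
  have 3: "cosh (b / 2) \<le> cosh (d / 2) \<longleftrightarrow> b \<le> d"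
    using assms(1) b(2) by (simp add: cosh_real_nonneg_le_iff)
  show "cosh d \<le> c * cosh (d / 2) \<longleftrightarrow> d \<le> b" using 1(1) 2 unfolding x_def b by simp
  show "cosh d = c * cosh (d / 2) \<longleftrightarrow> d = b" using 1(2) 2 3 unfolding x_def b by (metis order_antisym order_refl)
qed

theorem theorem1p1:
  fixes P :: "hyp set" and w :: real
  assumes "0 < w" and "ordinary_reduced_polygon P" and "minimal_width P = w"
  shows "diameter P \<le> 2 * arcosh ((cosh w + sqrt ((cosh w)\<^sup>2 + 8)) / 4)
    \<and> (diameter P = 2 * arcosh ((cosh w + sqrt ((cosh w)\<^sup>2 + 8)) / 4) \<longleftrightarrow> regular_triangle P)"
proof -
  define b where "b = 2 * arcosh ((cosh w + sqrt ((cosh w)\<^sup>2 + 8)) / 4)"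
  obtain v m T where star: "altitude_star (\<lambda>a. v (a mod (2 * m + 1))) T m (2 * m + 1) w"
    and ngon: "ngon_with_vertices P (2 * m + 1) v"
    using altitude_star_of_polygon[OF assms(1,3,2)] .
  define n where "n = 2 * m + 1"
  define V where "V a = v (a mod n)" for a
  interpret altitude_star V T m n w using star unfolding V_def n_def .
  note half = cosh_le_half_iff[OF zero_le_dist cosh_real_ge_1[of w], folded b_def]
  have poly: "hpolygon P" and vert: "hvertices P = v ` {..<n}" and card: "card (hvertices P) = n"
    using ngon bij_betw_same_card[of v "{..<n}" "hvertices P"]
    unfolding ngon_with_vertices_def n_def[symmetric] by (auto simp: bij_betw_def)
  \<comment> \<open>One of the two arcs between two vertices has at most \<open>m\<close> sides. For the arc that passes the
    index \<open>n\<close>, the start is \<open>k\<close> and the end is \<open>i + n\<close>.\<close>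
  have pair: "dist (v i) (v k) \<le> b \<and> (dist (v i) (v k) = b \<longrightarrow> m = 1)" if "i < k" "k < n" for i k
  proof -
    have vV: "v i = V i" "v k = V k" "V (i + n) = V i" using that by (simp_all add: V_def)
    show ?thesis
    proof (cases "k \<le> i + m")
      case True
      show ?thesis
        using cosh_dist_vertices_le[OF that(1) True] half[of "V i" "V k"] unfolding vV by blast
    next
      case False
      then have "k < i + n" "i + n \<le> k + m" using that n by auto
      then show ?thesis
        using cosh_dist_vertices_le[of k "i + n"] half[of "V k" "V i"]
        unfolding vV by (simp add: dist_commute)
    qed
  qed
  have "v 0 = V 0" "v 1 = V 1" using n m by (simp_all add: V_def)
  then have "0 < dist (v 0) (v 1)" using V_neq[of 0 1] n m by simp
  also have "dist (v 0) (v 1) \<le> b" using pair[of 0 1] n m by simp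
  finally have b: "0 < b" .
  have sym: "dist (v i) (v k) \<le> b \<and> (dist (v i) (v k) = b \<longrightarrow> m = 1)" if "i < n" "k < n" for i k
  proof -
    consider "i < k" | "k < i" | "i = k" by linarith
    then show ?thesis using pair[of i k] pair[of k i] that b by cases (auto simp: dist_commute)
  qed
  have le: "diameter P \<le> b"
    by (rule hpolygon_diameter_le[OF poly]) (use sym in \<open>auto simp: vert\<close>)
  have "m = 1" if eq: "diameter P = b"
  proof (rule ccontr)
    assume "m \<noteq> 1"
    define D where "D = Max ((\<lambda>(x, y). dist x y) ` (hvertices P \<times> hvertices P))"
    have fin: "finite (hvertices P \<times> hvertices P)" by (simp add: vert)
    have "v 0 \<in> hvertices P" using n vert by auto
    then have ne: "hvertices P \<times> hvertices P \<noteq> {}" by auto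
    have "D \<in> (\<lambda>(x, y). dist x y) ` (hvertices P \<times> hvertices P)"
      unfolding D_def using fin ne by (intro Max_in) auto
    then obtain i k where "i < n" "k < n" "D = dist (v i) (v k)" unfolding vert by auto
    then have "D < b" using sym[of i k] \<open>m \<noteq> 1\<close> by linarith
    moreover have "diameter P \<le> D"
      using fin unfolding D_def by (intro hpolygon_diameter_le[OF poly] Max_ge) auto
    ultimately show False using eq by simp
  qed
  moreover have "diameter P = b \<and> regular_triangle P" if "m = 1"
  proof -
    have n3: "n = 3" using n that by simp
    define d where "d = dist (v 0) (v 1)"
    have V: "V 0 = v 0" "V (Suc 0) = v 1" "V (Suc 1) = v 2" "V (Suc 2) = v 0" "V 1 = v 1" "V 2 = v 2"
      by (simp_all add: V_def n3 numeral_2_eq_2)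
    have d: "dist (v 0) (v 1) = d" "dist (v 1) (v 2) = d" "dist (v 2) (v 0) = d"
      using triangle_sides(1)[OF that, of 1 0] triangle_sides(1)[OF that, of 2 0] unfolding V d_def by simp_all
    have "d = b" using triangle_sides(2)[OF that, of 0] half(2)[of "v 0" "v 1"] unfolding V d_def by simp
    moreover have "v 0 \<in> P" "v 1 \<in> P" using hvertices_subset[of P] unfolding vert n3 by auto
    then have "d \<le> diameter P"
      unfolding d_def using poly
      by (intro diameter_bounded_bound compact_imp_bounded) (auto simp: hpolygon_def hconvex_body_def)
    ultimately have "diameter P = b" using le by simp
    moreover have "regular_triangle P"
      using ngon d unfolding n_def[symmetric] n3 by (intro equilateral_triangle_regular)
    ultimately show ?thesis ..
  qed
  moreover have "m = 1" if regular: "regular_triangle P"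
  proof -
    obtain u where "ngon_with_vertices P 3 u"
      using regular unfolding regular_ngon_def by blast
    then have "bij_betw u {..<3} (hvertices P)" by (simp add: ngon_with_vertices_def)
    then have "card (hvertices P) = 3" using bij_betw_same_card[of u "{..<3}"] by simp
    then show ?thesis using card n by simp
  qed
  ultimately show ?thesis using le unfolding b_def[symmetric] by blast
qed

end
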